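(* Let $p$ be a prime and let $\mathbb F_q$ be a finite field of characteristic $p$. A sequence $(u_n)_{n\ge 0}$ of elements of $\mathbb F_q$ is $p$-automatic if and only if there exist an integer $d\ge 1$, a linear cellular automaton $\Phi:(\mathbb F_q^d)^{\mathbb Z}\to\mathbb F_q^{\mathbb Z}$ with memory $d$, initial conditions $R_0,\dots,R_{d-1}\in\mathbb F_q^{\mathbb Z}$, each of which is eventually periodic in both directions, and an integer $m\in\mathbb Z$ such that the spacetime diagram $(R_n)_{n\ge 0}$ of $\Phi$ with these initial conditions satisfies $R_n(m)=u_n$ for all $n\ge 0$ (that is, $(u_n)_{n\ge0}$ is a column of this spacetime diagram).
   Context: Automatic sequences. For $k\ge 2$ let $\Sigma_k=\{0,1,\dots,k-1\}$. If $n=\sum_{i=0}^{l}a_ik^i$ is the standard base-$k$ representation of $n$, with $0\le a_i\le k-1$ and $a_l\ne 0$, let $(n)_k$ be the word $a_0a_1\cdots a_l$ (least significant digit first; $(0)_k$ is the empty word). A deterministic finite automaton with output (DFAO) is a 6-tuple $(\mathcal S,\Sigma_k,\delta,s_0,\mathcal A,\omega)$ with $\mathcal S$ a finite set of states, $s_0\in\mathcal S$ the initial state, $\mathcal A$ a finite alphabet, $\omega:\mathcal S\to\mathcal A$ the output function, and $\delta:\mathcal S\times\Sigma_k\to\mathcal S$ the transition function, extended to words by $\delta(s,a_0a_1\cdots a_l)=\delta(\delta(s,a_0),a_1\cdots a_l)$. A sequence $(u_n)_{n\ge0}$ in $\mathcal A$ is $k$-automatic if there is such a DFAO with $u_n=\omega(\delta(s_0,(n)_k))$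 for all $n\ge 0$. Cellular automata. For a finite alphabet $\mathcal A$ (discrete topology), $\mathcal A^{\mathbb Z}$ carries the product topology and the shift is $(\sigma(R))(m)=R(m+1)$. A cellular automaton with memory $d\ge1$ is a continuous map $\Phi:(\mathcal A^d)^{\mathbb Z}\to\mathcal A^{\mathbb Z}$ commuting with the shifts; its domain is identified with $(\mathcal A^{\mathbb Z})^d$. When $\mathcal A=\mathbb F_q$, $\Phi$ is linear if it is $\mathbb F_q$-linear; equivalently there are $l,r\ge0$ and coefficients $f_{j,i}\in\mathbb F_q$ with $(\Phi(R_0,\dots,R_{d-1}))(m)=\sum_{i=0}^{d-1}\sum_{j=-l}^{r}f_{j,i}R_i(m+j)$ for all $m\in\mathbb Z$ and all $R_0,\dots,R_{d-1}$. The spacetime diagram of $\Phi$ with initial conditions $R_0,\dots,R_{d-1}\in\mathcal A^{\mathbb Z}$ is the sequence $(R_n)_{n\ge0}$ with $R_n:=\Phi(R_{n-d},\dots,R_{n-1})$ for $n\ge d$. Its column $m$ is the sequence $(R_n(m))_{n\ge0}$. A configuration $R\in\mathcal A^{\mathbb Z}$ is eventually periodic in both directions if both one-sided sequences $(R(m))_{m\ge0}$ and $(R(-m))_{m\ge0}$ are eventually periodic. *)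

theory Defs
  imports
    "HOL-Analysis.Analysis"
    "HOL-Computational_Algebra.Computational_Algebra"
begin

text \<open>Standard base-\<open>k\<close> representation, least significant digit first; the guard
  \<open>k < 2\<close> only makes the recursion total.\<close>

fun base_digits :: "nat \<Rightarrow> nat \<Rightarrow> nat list" where
  "base_digits k n = (if n = 0 \<or> k < 2 then [] else n mod k # base_digits k (n div k))"

declare base_digits.simps [simp del]

lemma base_digits_standard:
  assumes "k \<ge> 2"
  shows "set (base_digits k n) \<subseteq> {..<k}"
    and "n = (\<Sum>i<length (base_digits k n). base_digits k n ! i * k ^ i)"
    and "base_digits k n \<noteq> [] \<Longrightarrow> last (base_digits k n) \<noteq> 0"
proof -
  have "set (base_digits k n) \<subseteq> {..<k}
    \<and> n = (\<Sum>i<length (base_digits k n). base_digits k n ! i * k ^ i)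
    \<and> (base_digits k n \<noteq> [] \<longrightarrow> last (base_digits k n) \<noteq> 0)"
  proof (induction n rule: less_induct)
    case (less n)
    show ?case
    proof (cases "n = 0")
      case True
      then show ?thesis by (simp add: base_digits.simps)
    next
      case False
      define w where "w = base_digits k (n div k)"
      have *: "base_digits k n = n mod k # w"
        using False assms by (simp add: base_digits.simps[of k n] w_def)
      have IH: "set w \<subseteq> {..<k}" "n div k = (\<Sum>i<length w. w ! i * k ^ i)"
        "w \<noteq> [] \<longrightarrow> last w \<noteq> 0"
        using less.IH[of "n div k"] False assms by (auto simp: w_def)
      have "n = n mod k + k * (n div k)" by simp
      also have "\<dots> = (\<Sum>i<length (n mod k # w). (n mod k # w) ! i * k ^ i)"
        unfolding IH(2) by (simp add: sum.lessThan_Suc_shift sum_distrib_left mult_ac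
            del: sum.lessThan_Suc)
      finally have sum: "n = (\<Sum>i<length (n mod k # w). (n mod k # w) ! i * k ^ i)" .
      have "last (n mod k # w) \<noteq> 0"
      proof (cases "w = []")
        case True
        then show ?thesis using sum False by simp
      qed (use IH in auto)
      then show ?thesis using IH(1) sum assms unfolding * by auto
    qed
  qed
  then show "set (base_digits k n) \<subseteq> {..<k}"
    and "n = (\<Sum>i<length (base_digits k n). base_digits k n ! i * k ^ i)"
    and "base_digits k n \<noteq> [] \<Longrightarrow> last (base_digits k n) \<noteq> 0"
    by blast+
qed

record ('s, 'a) dfao =
  states :: "'s set"
  trans :: "'s \<Rightarrow> nat \<Rightarrow> 's"
  start :: 's
  out :: "'s \<Rightarrow> 'a"

definition is_dfao :: "nat \<Rightarrow> 'a set \<Rightarrow> ('s, 'a) dfao \<Rightarrow> bool" where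
  "is_dfao k A M \<longleftrightarrow>
     finite (states M) \<and> finite A \<and> start M \<in> states M \<and>
     (\<forall>s\<in>states M. \<forall>a<k. trans M s a \<in> states M) \<and>
     (\<forall>s\<in>states M. out M s \<in> A)"

definition generates :: "nat \<Rightarrow> ('s, 'a) dfao \<Rightarrow> (nat \<Rightarrow> 'a) \<Rightarrow> bool" where
  "generates k M u \<longleftrightarrow> (\<forall>n. u n = out M (foldl (trans M) (start M) (base_digits k n)))"

text \<open>States are taken to be natural numbers, since HOL cannot quantify over the type of
  states; lemma \<open>automaticI\<close> shows that this is no restriction.\<close>

definition automatic :: "nat \<Rightarrow> 'a set \<Rightarrow> (nat \<Rightarrow> 'a) \<Rightarrow> bool" where
  "automatic k A u \<longleftrightarrow> k \<ge> 2 \<and> (\<exists>M :: (nat, 'a) dfao. is_dfao k A M \<and> generates k M u)"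

lemma automaticI:
  fixes M :: "('s, 'a) dfao"
  assumes "k \<ge> 2" and M: "is_dfao k A M" and "generates k M u"
  shows "automatic k A u"
proof -
  from M have "finite (states M)" by (simp add: is_dfao_def)
  then obtain g :: "'s \<Rightarrow> nat" where g: "inj_on g (states M)"
    using finite_imp_inj_to_nat_seg by metis
  define h where "h = the_inv_into (states M) g"
  have h: "h (g s) = s" if "s \<in> states M" for s
    using g that by (simp add: h_def the_inv_into_f_f)
  define N where "N = \<lparr>states = g ` states M, trans = (\<lambda>s a. g (trans M (h s) a)),
    start = g (start M), out = (\<lambda>s. out M (h s))\<rparr>"
  have "is_dfao k A N"
    using M by (auto simp: is_dfao_def N_def h)
  moreover have "foldl (trans N) (g s) w = g (foldl (trans M) s w) \<and> foldl (trans M) s w \<in> states M"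
    if "s \<in> states M" "set w \<subseteq> {..<k}" for s w
    using that
  proof (induction w arbitrary: s)
    case (Cons a w)
    moreover have "trans M s a \<in> states M" using M Cons.prems by (auto simp: is_dfao_def)
    moreover have "trans N (g s) a = g (trans M s a)" using Cons.prems by (simp add: N_def h)
    ultimately show ?case by simp
  qed simp
  then have "generates k N u"
    using assms base_digits_standard(1)[OF assms(1)]
    by (simp add: generates_def is_dfao_def h) (simp add: N_def is_dfao_def h)
  ultimately show ?thesis using assms(1) unfolding automatic_def by blast
qed

text \<open>The alphabet is the type \<open>'a\<close>. As \<open>d\<close> varies, \<open>'a\<^sup>d\<close> is the set of functions on
  \<open>{..<d}\<close>, extended by \<open>undefined\<close>, so that an element of \<open>('a\<^sup>d)\<^sup>\<int>\<close> is
  a function \<open>int \<Rightarrow> nat \<Rightarrow> 'a\<close>.\<close>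

definition tuples :: "nat \<Rightarrow> (nat \<Rightarrow> 'a) set" where
  "tuples d = (\<Pi>\<^sub>E i\<in>{..<d}. UNIV)"

definition configs :: "'b set \<Rightarrow> (int \<Rightarrow> 'b) topology" where
  "configs B = product_topology (\<lambda>_. discrete_topology B) UNIV"

definition shift :: "(int \<Rightarrow> 'b) \<Rightarrow> int \<Rightarrow> 'b" where
  "shift X = (\<lambda>m. X (m + 1))"

definition cellular_automaton :: "nat \<Rightarrow> ((int \<Rightarrow> nat \<Rightarrow> 'a) \<Rightarrow> int \<Rightarrow> 'a) \<Rightarrow> bool" where
  "cellular_automaton d \<Phi> \<longleftrightarrow>
     d \<ge> 1 \<and> finite (UNIV :: 'a set) \<and>
     continuous_map (configs (tuples d)) (configs UNIV) \<Phi> \<and>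
     (\<forall>X \<in> topspace (configs (tuples d)). \<Phi> (shift X) = shift (\<Phi> X))"

definition linear_cellular_automaton ::
    "nat \<Rightarrow> ((int \<Rightarrow> nat \<Rightarrow> 'a::field) \<Rightarrow> int \<Rightarrow> 'a) \<Rightarrow> bool" where
  "linear_cellular_automaton d \<Phi> \<longleftrightarrow>
     cellular_automaton d \<Phi> \<and>
     (\<forall>X \<in> topspace (configs (tuples d)). \<forall>Y \<in> topspace (configs (tuples d)).
        \<Phi> (\<lambda>m. \<lambda>i\<in>{..<d}. X m i + Y m i) = (\<lambda>m. \<Phi> X m + \<Phi> Y m)) \<and>
     (\<forall>c. \<forall>X \<in> topspace (configs (tuples d)).
        \<Phi> (\<lambda>m. \<lambda>i\<in>{..<d}. c * X m i) = (\<lambda>m. c * \<Phi> X m))"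

lemma topspace_configs: "X \<in> topspace (configs (tuples d)) \<longleftrightarrow> (\<forall>m. X m \<in> extensional {..<d})"
  by (auto simp: configs_def tuples_def PiE_def)

lemma openin_cylinder:
  assumes "finite K" "X \<in> topspace (configs (tuples d))"
  shows "openin (configs (tuples d)) {Y \<in> topspace (configs (tuples d)). \<forall>k\<in>K. Y k = X k}"
proof -
  have "{Y \<in> topspace (configs (tuples d)). \<forall>k\<in>K. Y k = X k}
     = (\<Pi>\<^sub>E k\<in>UNIV. if k \<in> K then {X k} else tuples d)"
    using assms(2) by (force simp: configs_def PiE_def Pi_def split: if_splits)
  also have "openin (configs (tuples d)) \<dots>"
    unfolding configs_def
    using assms by (intro product_topology_basis)
      (auto simp: configs_def PiE_def Pi_def intro: finite_subset[of _ K] split: if_splits)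
  finally show ?thesis .
qed

text \<open>Linearity and continuity together amount to a finite local rule with coefficients in the field.\<close>

lemma linear_cellular_automaton_iff:
  fixes \<Phi> :: "(int \<Rightarrow> nat \<Rightarrow> 'a :: field) \<Rightarrow> int \<Rightarrow> 'a"
  shows "linear_cellular_automaton d \<Phi> \<longleftrightarrow>
     d \<ge> 1 \<and> finite (UNIV :: 'a set) \<and>
     (\<exists>l r :: nat. \<exists>f :: int \<Rightarrow> nat \<Rightarrow> 'a. \<forall>X \<in> topspace (configs (tuples d)). \<forall>m.
        \<Phi> X m = (\<Sum>i<d. \<Sum>j=-int l..int r. f j i * X (m + j) i))"
    (is "?L \<longleftrightarrow> ?R")
proof
  assume ?R
  then obtain l r :: nat and f where fin: "d \<ge> 1" "finite (UNIV :: 'a set)"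
    and f: "\<And>X m. X \<in> topspace (configs (tuples d)) \<Longrightarrow>
      \<Phi> X m = (\<Sum>i<d. \<Sum>j=-int l..int r. f j i * X (m + j) i)" by blast
  have cont: "continuous_map (configs (tuples d)) (configs UNIV) \<Phi>"
    unfolding configs_def[of "UNIV :: 'a set"] continuous_map_componentwise_UNIV
  proof
    fix m
    show "continuous_map (configs (tuples d)) (discrete_topology UNIV) (\<lambda>X. \<Phi> X m)"
      unfolding continuous_map_def
    proof (intro conjI allI impI)
      fix U :: "'a set"
      show "openin (configs (tuples d)) {X \<in> topspace (configs (tuples d)). \<Phi> X m \<in> U}"
      proof (subst openin_subopen, intro ballI)
        fix X assume X: "X \<in> {X \<in> topspace (configs (tuples d)). \<Phi> X m \<in> U}"
        let ?T = "{Y \<in> topspace (configs (tuples d)). \<forall>k\<in>{m - int l..m + int r}. Y k = X k}"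
        have "\<Phi> Y m = \<Phi> X m" if "Y \<in> ?T" for Y
        proof -
          have Y: "Y \<in> topspace (configs (tuples d))" and X': "X \<in> topspace (configs (tuples d))"
            using that X by auto
          have "Y (m + j) = X (m + j)" if "j \<in> {- int l..int r}" for j
            using \<open>Y \<in> ?T\<close> that by auto
          then show ?thesis unfolding f[OF Y] f[OF X'] by (intro sum.cong) auto
        qed
        then show "\<exists>T. openin (configs (tuples d)) T \<and> X \<in> T \<and>
            T \<subseteq> {X \<in> topspace (configs (tuples d)). \<Phi> X m \<in> U}"
        proof (intro exI conjI)
          show "openin (configs (tuples d)) ?T" using X by (intro openin_cylinder) auto
          show "X \<in> ?T" using X by auto
          show "?T \<subseteq> {X \<in> topspace (configs (tuples d)). \<Phi> X m \<in> U}"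
          proof
            fix Y assume "Y \<in> ?T"
            with \<open>Y \<in> ?T \<Longrightarrow> \<Phi> Y m = \<Phi> X m\<close> X show "Y \<in> {X \<in> topspace (configs (tuples d)). \<Phi> X m \<in> U}"
              by (metis (mono_tags, lifting) mem_Collect_eq)
          qed
        qed
      qed
    qed auto
  qed
  show ?L
    unfolding linear_cellular_automaton_def cellular_automaton_def
  proof (intro conjI ballI allI)
    fix X :: "int \<Rightarrow> nat \<Rightarrow> 'a" assume X: "X \<in> topspace (configs (tuples d))"
    have "shift X \<in> topspace (configs (tuples d))" using X by (simp add: topspace_configs shift_def)
    then show "\<Phi> (shift X) = shift (\<Phi> X)" using X by (auto simp: f fun_eq_iff) (simp add: f shift_def algebra_simps)
    fix c
    show "\<Phi> (\<lambda>m. \<lambda>i\<in>{..<d}. c * X m i) = (\<lambda>m. c * \<Phi> X m)"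
      using X by (auto simp: topspace_configs f sum_distrib_left algebra_simps fun_eq_iff)
    fix Y :: "int \<Rightarrow> nat \<Rightarrow> 'a" assume Y: "Y \<in> topspace (configs (tuples d))"
    show "\<Phi> (\<lambda>m. \<lambda>i\<in>{..<d}. X m i + Y m i) = (\<lambda>m. \<Phi> X m + \<Phi> Y m)"
      using X Y by (auto simp: topspace_configs f sum.distrib[symmetric] algebra_simps fun_eq_iff)
  qed (use fin cont in auto)
next
  assume L: ?L
  let ?T = "topspace (configs (tuples d)) :: (int \<Rightarrow> nat \<Rightarrow> 'a) set"
  from L have d: "d \<ge> 1" "finite (UNIV :: 'a set)"
    and cont: "continuous_map (configs (tuples d)) (configs UNIV) \<Phi>"
    and sh: "\<And>X. X \<in> ?T \<Longrightarrow> \<Phi> (shift X) = shift (\<Phi> X)"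
    and add: "\<And>X Y. X \<in> ?T \<Longrightarrow> Y \<in> ?T \<Longrightarrow> \<Phi> (\<lambda>m. \<lambda>i\<in>{..<d}. X m i + Y m i) = (\<lambda>m. \<Phi> X m + \<Phi> Y m)"
    and scale: "\<And>X c. X \<in> ?T \<Longrightarrow> \<Phi> (\<lambda>m. \<lambda>i\<in>{..<d}. c * X m i) = (\<lambda>m. c * \<Phi> X m)"
    unfolding linear_cellular_automaton_def cellular_automaton_def by blast+
  define Z :: "int \<Rightarrow> nat \<Rightarrow> 'a" where "Z = (\<lambda>m. \<lambda>i\<in>{..<d}. 0)"
  have Z: "Z \<in> ?T" by (auto simp: topspace_configs Z_def)
  have PZ: "\<Phi> Z = (\<lambda>m. 0)"
    using scale[OF Z, of 0] by (simp add: Z_def)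
  have c0: "continuous_map (configs (tuples d)) (discrete_topology UNIV) (\<lambda>X. \<Phi> X 0)"
    using cont unfolding configs_def[of "UNIV :: 'a set"] continuous_map_componentwise_UNIV by blast
  then have "openin (configs (tuples d)) {X \<in> ?T. \<Phi> X 0 \<in> {0}}"
    by (rule openin_continuous_map_preimage) auto
  then have op: "openin (product_topology (\<lambda>_::int. discrete_topology (tuples d)) UNIV) {X \<in> ?T. \<Phi> X 0 \<in> {0}}"
    by (simp only: configs_def)
  have ZZ: "Z \<in> {X \<in> ?T. \<Phi> X 0 \<in> {0}}" using Z PZ by simp
  obtain B where B: "Z \<in> (\<Pi>\<^sub>E k\<in>UNIV. B k)"
      "finite {k. B k \<noteq> tuples d}" "(\<Pi>\<^sub>E k\<in>UNIV. B k) \<subseteq> {X \<in> ?T. \<Phi> X 0 \<in> {0}}"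
    using product_topology_open_contains_basis[OF op ZZ] unfolding topspace_discrete_topology by blast
  obtain N :: nat where N: "\<And>k. B k \<noteq> tuples d \<Longrightarrow> \<bar>k\<bar> \<le> int N"
  proof -
    have "finite ((\<lambda>k. nat \<bar>k\<bar>) ` {k. B k \<noteq> tuples d})" using B by blast
    then obtain N where "\<forall>x \<in> (\<lambda>k. nat \<bar>k\<bar>) ` {k. B k \<noteq> tuples d}. x \<le> N"
      using finite_nat_set_iff_bounded_le by blast
    then show ?thesis by (intro that[of N]) auto
  qed
  have van: "\<Phi> X 0 = 0" if X: "X \<in> ?T" and "\<And>k. \<bar>k\<bar> \<le> int N \<Longrightarrow> X k = Z k" for X
  proof -
    have "X k \<in> B k" for k
    proof (cases "\<bar>k\<bar> \<le> int N")
      case True then show ?thesis using that B by (auto simp: PiE_def Pi_def)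
    next
      case False
      then have "B k = tuples d" using N by blast
      then show ?thesis using X by (auto simp: configs_def)
    qed
    then show ?thesis using B by (auto simp: PiE_def Pi_def)
  qed
  define E :: "int \<Rightarrow> nat \<Rightarrow> int \<Rightarrow> nat \<Rightarrow> 'a" where
    "E j i = (\<lambda>m. \<lambda>i'\<in>{..<d}. if m = j \<and> i' = i then 1 else 0)" for j i
  have E: "E j i \<in> ?T" for j i by (auto simp: topspace_configs E_def)
  define f where "f j i = \<Phi> (E j i) 0" for j i
  have comb: "(\<lambda>m. \<lambda>i\<in>{..<d}. \<Sum>s\<in>S. c s * W s m i) \<in> ?T \<and>
      \<Phi> (\<lambda>m. \<lambda>i\<in>{..<d}. \<Sum>s\<in>S. c s * W s m i) 0 = (\<Sum>s\<in>S. c s * \<Phi> (W s) 0)"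
    if "finite S" "\<And>s. s \<in> S \<Longrightarrow> W s \<in> ?T" for S :: "(nat \<times> int) set" and c W
    using that
  proof (induction S rule: finite_induct)
    case empty
    then show ?case using Z PZ by (simp add: Z_def restrict_def)
  next
    case (insert s S)
    let ?A = "\<lambda>m. \<lambda>i\<in>{..<d}. c s * W s m i"
    let ?B = "\<lambda>m. \<lambda>i\<in>{..<d}. \<Sum>s\<in>S. c s * W s m i"
    have A: "?A \<in> ?T" by (auto simp: topspace_configs)
    let ?C = "\<lambda>m. \<lambda>i\<in>{..<d}. \<Sum>s\<in>insert s S. c s * W s m i"
    have 1: "?C = (\<lambda>m. \<lambda>i\<in>{..<d}. ?A m i + ?B m i)"
      using insert by (auto simp: fun_eq_iff)
    have IH: "?B \<in> ?T" "\<Phi> ?B 0 = (\<Sum>s\<in>S. c s * \<Phi> (W s) 0)"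
      using insert by blast+
    have "\<Phi> ?C 0 = \<Phi> ?A 0 + \<Phi> ?B 0"
      unfolding 1 by (subst add[OF A IH(1)]) simp
    moreover have "\<Phi> ?A 0 = c s * \<Phi> (W s) 0" by (subst scale) (use insert in auto)
    moreover have "?C \<in> ?T" unfolding topspace_configs using restrict_extensional by blast
    ultimately show ?case using insert(1,2) IH(2) by (metis (no_types, lifting) sum.insert)
  qed
  have main: "\<Phi> X 0 = (\<Sum>i<d. \<Sum>j=-int N..int N. f j i * X j i)" if X: "X \<in> ?T" for X
  proof -
    let ?S = "{..<d} \<times> {-int N..int N}"
    let ?W = "\<lambda>(i, j). E j i"
    let ?c = "\<lambda>(i, j). X j i"
    define Y where "Y = (\<lambda>m. \<lambda>i\<in>{..<d}. \<Sum>s\<in>?S. ?c s * ?W s m i)"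
    have Y: "Y \<in> ?T" "\<Phi> Y 0 = (\<Sum>s\<in>?S. ?c s * \<Phi> (?W s) 0)"
      using comb[of ?S ?W ?c] E unfolding Y_def by auto
    have Yk: "Y k i = X k i" if "\<bar>k\<bar> \<le> int N" "i < d" for k i
    proof -
      have "Y k i = (\<Sum>s\<in>?S. if s = (i, k) then X k i else 0)"
      proof -
        have "Y k i = (\<Sum>s\<in>?S. ?c s * ?W s k i)" unfolding Y_def using that by simp
        also have "\<dots> = (\<Sum>s\<in>?S. if s = (i, k) then X k i else 0)"
          by (intro sum.cong refl) (use that in \<open>auto simp: E_def split: if_splits\<close>)
        finally show ?thesis .
      qed
      then show ?thesis using that by (auto simp: abs_le_iff)
    qed
    define D where "D = (\<lambda>m. \<lambda>i\<in>{..<d}. X m i + (\<lambda>m. \<lambda>i\<in>{..<d}. (-1) * Y m i) m i)"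
    have mY: "(\<lambda>m. \<lambda>i\<in>{..<d}. (-1) * Y m i) \<in> ?T" by (auto simp: topspace_configs)
    have "\<Phi> D 0 = \<Phi> X 0 - \<Phi> Y 0"
      unfolding D_def using add[OF X mY] scale[OF Y(1), of "-1"] by simp
    moreover have "\<Phi> D 0 = 0"
      by (rule van) (auto simp: D_def topspace_configs Z_def Yk fun_eq_iff)
    ultimately show ?thesis
      using Y(2) by (simp add: f_def sum.cartesian_product split_def mult.commute)
  qed
  have sh1: "shift X \<in> ?T" "(\<lambda>k. X (k + m)) \<in> ?T" if "X \<in> ?T" for X m
    using that by (auto simp: topspace_configs shift_def)
  have pos: "\<Phi> (\<lambda>k. X (k + int n)) = (\<lambda>k. \<Phi> X (k + int n))" if "X \<in> ?T" for X n
    using that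
  proof (induction n arbitrary: X)
    case (Suc n)
    have "\<Phi> (\<lambda>k. shift X (k + int n)) = (\<lambda>k. \<Phi> (shift X) (k + int n))"
      using Suc sh1 by blast
    then show ?case using sh[OF Suc.prems] by (simp add: shift_def algebra_simps)
  qed auto
  have all: "\<Phi> (\<lambda>k. X (k + m)) = (\<lambda>k. \<Phi> X (k + m))" if X: "X \<in> ?T" for X m
  proof (cases "m \<ge> 0")
    case True then show ?thesis using pos[OF X, of "nat m"] by simp
  next
    case False
    have "\<Phi> X = (\<lambda>k. \<Phi> (\<lambda>k. X (k + m)) (k + int (nat (-m))))"
      using pos[OF sh1(2)[OF X, of m], of "nat (-m)"] False by simp
    then have *: "\<Phi> X k = \<Phi> (\<lambda>k. X (k + m)) (k + int (nat (-m)))" for k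
      by (rule fun_cong)
    show ?thesis using *[of "_ + m"] False by (intro ext) simp
  qed
  have "\<Phi> X m = (\<Sum>i<d. \<Sum>j=-int N..int N. f j i * X (m + j) i)" if X: "X \<in> ?T" for X m
    using main[OF sh1(2)[OF X, of m]] all[OF X, of m] by (simp add: add.commute)
  then show ?R using d by blast
qed

text \<open>The identification of \<open>('a\<^sup>\<int>)\<^sup>d\<close> with \<open>('a\<^sup>d)\<^sup>\<int>\<close>; only \<open>R 0, \<dots>, R (d - 1)\<close> matter.\<close>

definition join_configs :: "nat \<Rightarrow> (nat \<Rightarrow> int \<Rightarrow> 'a) \<Rightarrow> int \<Rightarrow> nat \<Rightarrow> 'a" where
  "join_configs d R = (\<lambda>m. \<lambda>i\<in>{..<d}. R i m)"

lemma join_configs_cong [fundef_cong]: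
  assumes "d = d'" "\<And>i. i < d' \<Longrightarrow> R i = R' i"
  shows "join_configs d R = join_configs d' R'"
  using assms by (auto simp: join_configs_def intro!: ext)

text \<open>Only \<open>R 0, \<dots>, R (d - 1)\<close> are used as initial conditions; for \<open>d = 0\<close>, where there is no
  recurrence, the value is irrelevant.\<close>

function spacetime_diagram ::
    "nat \<Rightarrow> ((int \<Rightarrow> nat \<Rightarrow> 'a) \<Rightarrow> int \<Rightarrow> 'a) \<Rightarrow> (nat \<Rightarrow> int \<Rightarrow> 'a) \<Rightarrow> nat \<Rightarrow> int \<Rightarrow> 'a" where
  "spacetime_diagram d \<Phi> R n =
     (if n < d then R n
      else \<Phi> (join_configs d (\<lambda>i. spacetime_diagram d \<Phi> R (n - d + i))))"
  by auto
termination by (relation "Wellfounded.measure (\<lambda>(d, \<Phi>, R, n). n)") auto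

declare spacetime_diagram.simps [simp del]

definition eventually_periodic :: "(nat \<Rightarrow> 'a) \<Rightarrow> bool" where
  "eventually_periodic s \<longleftrightarrow> (\<exists>N. \<exists>P\<ge>1. \<forall>n\<ge>N. s (n + P) = s n)"

definition eventually_periodic_both :: "(int \<Rightarrow> 'a) \<Rightarrow> bool" where
  "eventually_periodic_both R \<longleftrightarrow>
     eventually_periodic (\<lambda>m. R (int m)) \<and> eventually_periodic (\<lambda>m. R (- int m))"

end

theory Submission
  imports Defs "HOL-Library.Poly_Mapping"
begin

text \<open>
  Columns are automatic. Extend the spacetime diagram by zero to an array indexed by
  \<open>\<int> \<times> \<int>\<close>. The local rule becomes a Laurent polynomial \<open>D\<close> acting on such arrays, and
  \<open>D G = N\<close> where \<open>N\<close> has finitely many nonzero rows, each periodic far out in both directions.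
  The decimation \<open>\<Lambda>\<close> with \<open>\<Lambda> G (n, m) = G (p n + r, p m)\<close> satisfies
  \<open>D' (\<Lambda> G) = \<Lambda> (D\<^sup>p G) = \<Lambda> (D\<^sup>p\<^sup>-\<^sup>1 N)\<close>, where \<open>D'\<close> has the \<open>p\<close>-th powers of the coefficients of
  \<open>D\<close>, and the bounds on the rows of \<open>N\<close> are preserved. As \<open>D\<close> is injective on arrays
  vanishing at negative times, there are only finitely many iterated decimations.

  Automatic sequences are columns. With \<open>Q\<close> a power of \<open>p\<close> such that \<open>c\<^sup>Q = c\<close> in the field, the
  finite kernel yields a polynomial relation \<open>\<Sum>j. c\<^sub>j y^(Q^j) = 0\<close> with \<open>c\<^sub>0 \<noteq> 0\<close> for the generating
  function \<open>y\<close>. Removing an initial segment, \<open>y = T + t\<^sup>k z\<close>, one gets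
  \<open>A z + (\<Sum>j\<ge>1. C\<^sub>j z^(Q^j)) + B = 0\<close> where, at \<open>t = 0\<close>, \<open>A\<close> is nonzero and \<open>C\<^sub>j\<close>, \<open>B\<close>, \<open>z\<close>
  vanish. For \<open>P = A x + (\<Sum>j\<ge>1. C\<^sub>j x^(Q^j)) + B\<close>, additivity of \<open>Q\<close>-th powers gives
  \<open>P(x) = (x - z) (A + (x - z) E)\<close>, so \<open>A / P\<close> differs from \<open>1 / (x - z) = \<Sum>k. z^k / x^(k + 1)\<close>
  by a series without negative powers of \<open>x\<close>, and its coefficient at \<open>x\<^sup>-\<^sup>2\<close> is \<open>z\<close>. Since
  \<open>P = A x\<close> at \<open>t = 0\<close>, the denominator \<open>P\<close> is the local rule of a linear cellular automaton
  with initial conditions of finite support.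
\<close>

unbundle no vec_syntax

subsection \<open>Laurent polynomials acting on arrays\<close>

text \<open>With its convolution product, \<open>'w \<Rightarrow>\<^sub>0 'a\<close> is the group
  algebra of \<open>'w\<close>; over \<open>int \<times> int\<close> its elements are Laurent
  polynomials in two variables. Arrays may have infinite support, so they form a module over this
  algebra: the monomial at \<open>w\<close> translates an array by \<open>w\<close>.\<close>

definition act :: "('w::ab_group_add \<Rightarrow>\<^sub>0 'a::comm_ring_1) \<Rightarrow> ('w \<Rightarrow> 'a) \<Rightarrow> 'w \<Rightarrow> 'a" where
  "act P G v = (\<Sum>w\<in>Poly_Mapping.keys P. Poly_Mapping.lookup P w * G (v - w))"

lemma act_superset:
  assumes "finite W" "Poly_Mapping.keys P \<subseteq> W"
  shows "act P G v = (\<Sum>w\<in>W. Poly_Mapping.lookup P w * G (v - w))"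
  unfolding act_def using assms by (intro sum.mono_neutral_left) (auto simp: in_keys_iff)

lemma act_add: "act (P + Q) G v = act P G v + act Q G v"
proof -
  let ?W = "Poly_Mapping.keys P \<union> Poly_Mapping.keys Q"
  have "Poly_Mapping.keys (P + Q) \<subseteq> ?W"
    by (rule Poly_Mapping.keys_add)
  then show ?thesis
    by (simp add: act_superset[of ?W] lookup_add distrib_right sum.distrib)
qed

lemma act_sum: "act (sum f A) G v = (\<Sum>x\<in>A. act (f x) G v)"
  by (induction A rule: infinite_finite_induct) (simp_all add: act_add, simp_all add: act_def)

lemma act_single: "act (Poly_Mapping.single w c) G v = c * G (v - w)"
  by (simp add: act_superset[of "{w}"])

lemma act_one: "act 1 G = G"
  using act_single[of 0 1 G] by (simp add: fun_eq_iff)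

lemma sum_singles_keys: "(\<Sum>w\<in>Poly_Mapping.keys P. Poly_Mapping.single w (Poly_Mapping.lookup P w)) = P"
proof (rule poly_mapping_eqI)
  fix k
  have "Poly_Mapping.lookup (\<Sum>w\<in>Poly_Mapping.keys P. Poly_Mapping.single w (Poly_Mapping.lookup P w)) k
    = (\<Sum>w\<in>Poly_Mapping.keys P. if w = k then Poly_Mapping.lookup P w else 0)"
    by (auto simp: lookup_sum lookup_single when_def intro!: sum.cong)
  then show "Poly_Mapping.lookup (\<Sum>w\<in>Poly_Mapping.keys P. Poly_Mapping.single w (Poly_Mapping.lookup P w)) k
    = Poly_Mapping.lookup P k"
    by (simp add: in_keys_iff)
qed

lemma act_mult: "act (P * Q) G v = act P (act Q G) v"
proof -
  let ?s = "\<lambda>P w. Poly_Mapping.single w (Poly_Mapping.lookup P w)"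
  let ?K = "Poly_Mapping.keys"
  have "act (P * Q) G v = act ((\<Sum>w\<in>?K P. ?s P w) * (\<Sum>w\<in>?K Q. ?s Q w)) G v"
    by (simp add: sum_singles_keys)
  also have "\<dots> = (\<Sum>w\<in>?K P. \<Sum>w'\<in>?K Q.
      Poly_Mapping.lookup P w * Poly_Mapping.lookup Q w' * G (v - (w + w')))"
    by (simp add: sum_product act_sum mult_single act_single)
  also have "\<dots> = act P (act Q G) v"
    by (simp add: act_def sum_distrib_left mult.assoc diff_diff_add)
  finally show ?thesis .
qed

lemma act_power: "act (P ^ n) G = (act P ^^ n) G"
proof (induction n)
  case (Suc n)
  have "act (P ^ Suc n) G = act P (act (P ^ n) G)"
    by (simp add: fun_eq_iff act_mult)
  then show ?case by (simp add: Suc)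
qed (simp add: act_one)

section \<open>Characteristic and Frobenius\<close>

lemma CHAR_poly_mapping: "CHAR('w::comm_monoid_add \<Rightarrow>\<^sub>0 'a::comm_ring_1) = CHAR('a)"
  by (rule CHAR_eqI)
    (auto simp flip: single_of_nat simp: of_nat_eq_0_iff_char_dvd[symmetric] poly_mapping_eq_iff
      fun_eq_iff lookup_single when_def split: if_splits)

text \<open>The exponent \<open>((+) w ^^ n) 0\<close> is the \<open>n\<close>-fold multiple of
  \<open>w\<close>.\<close>

lemma single_power:
  "Poly_Mapping.single w c ^ n = Poly_Mapping.single (((+) w ^^ n) 0) (c ^ n)"
  by (induction n) (auto simp: mult_single)

text \<open>Frobenius is additive, hence injective. A finite field has only finitely many self-maps,
  so two iterates of Frobenius coincide, and injectivity cancels the smaller one.\<close>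

lemma finite_field_power_CHAR_ex:
  "\<exists>e>0. \<forall>x :: 'a::finite_field. x ^ (CHAR('a) ^ e) = x"
proof -
  define f :: "'a \<Rightarrow> 'a" where "f = (\<lambda>x. x ^ CHAR('a))"
  have "inj f"
  proof (rule injI)
    fix x y :: 'a assume "f x = f y"
    moreover have "f ((x - y) + y) = f (x - y) + f y"
      unfolding f_def by (rule freshmans_dream) auto
    ultimately show "x = y" by (simp add: f_def)
  qed
  have fe: "(f ^^ e) x = x ^ (CHAR('a) ^ e)" for e x
    by (induction e) (simp_all add: f_def power_mult mult.commute flip: power_mult)
  have "\<not> inj (\<lambda>e::nat. f ^^ e)"
    using finite_imageD[of "\<lambda>e. f ^^ e" UNIV] by auto
  then obtain i j where ij: "f ^^ i = f ^^ j" "i < j"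
    unfolding inj_def by (metis linorder_neqE_nat)
  have "(f ^^ (j - i)) x = x" for x
  proof -
    have "(f ^^ i) ((f ^^ (j - i)) x) = (f ^^ i) x"
    proof -
      have "f ^^ j = f ^^ i \<circ> f ^^ (j - i)" using ij(2) by (simp flip: funpow_add)
      then show ?thesis by (metis comp_apply ij(1))
    qed
    then show ?thesis using inj_fn[OF \<open>inj f\<close>] by (auto dest: injD)
  qed
  then show ?thesis using ij fe by (intro exI[of _ "j - i"]) simp
qed

section \<open>Arrays whose rows are periodic far out\<close>

definition periodic_beyond :: "nat \<Rightarrow> nat \<Rightarrow> (int \<Rightarrow> 'a) \<Rightarrow> bool" where
  "periodic_beyond P b g \<longleftrightarrow>
     (\<forall>m\<ge>int b. g (m + int P) = g m) \<and> (\<forall>m\<le>-int b. g (m - int P) = g m)"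

lemma periodic_beyond_mult:
  assumes "periodic_beyond P b g"
  shows "periodic_beyond (k * P) b g"
proof (induction k)
  case (Suc k)
  have g: "g (m + int P) = g m" if "m \<ge> int b" for m
    using assms that by (auto simp: periodic_beyond_def)
  have g': "g (m - int P) = g m" if "m \<le> - int b" for m
    using assms that by (auto simp: periodic_beyond_def)
  have "int (k * P) \<ge> 0" by simp
  then have "g (m + int (k * P) + int P) = g (m + int (k * P))" if "m \<ge> int b" for m
    using that by (intro g) linarith
  moreover have "g (m - int (k * P) - int P) = g (m - int (k * P))" if "m \<le> - int b" for m
    using that \<open>int (k * P) \<ge> 0\<close> by (intro g') linarith
  ultimately show ?case
    using Suc unfolding periodic_beyond_def by (simp add: algebra_simps)
qed (simp add: periodic_beyond_def)

lemma periodic_beyond_mono: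
  assumes "periodic_beyond P b g" "P dvd P'" "b \<le> b'"
  shows "periodic_beyond P' b' g"
proof -
  obtain k where "P' = k * P" using assms(2) by (metis dvdE mult.commute)
  then have "periodic_beyond P' b g" using periodic_beyond_mult assms(1) by blast
  then show ?thesis using assms(3) by (auto simp: periodic_beyond_def)
qed

lemma periodic_beyond_shift:
  assumes "periodic_beyond P b g"
  shows "periodic_beyond P (b + nat \<bar>m\<bar>) (\<lambda>k. g (m + k))"
  unfolding periodic_beyond_def
proof (intro conjI allI impI)
  fix k :: int
  show "g (m + (k + int P)) = g (m + k)" if "int (b + nat \<bar>m\<bar>) \<le> k"
  proof -
    have "int b \<le> m + k" using that by linarith
    then show ?thesis using assms by (simp add: periodic_beyond_def flip: add.assoc)
  qed
  show "g (m + (k - int P)) = g (m + k)" if "k \<le> - int (b + nat \<bar>m\<bar>)"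
  proof -
    have "m + k \<le> - int b" using that by linarith
    then show ?thesis using assms by (simp add: periodic_beyond_def add_diff_eq)
  qed
qed

text \<open>The product of the periods of the two tails is a period of both, beyond the larger of
  the two thresholds.\<close>

lemma periodic_beyond_if_eventually_periodic_both:
  assumes "eventually_periodic_both g"
  shows "\<exists>P\<ge>1. \<exists>b. periodic_beyond P b g"
proof -
  from assms obtain N P where NP: "P \<ge> 1" "\<And>n. n \<ge> N \<Longrightarrow> g (int (n + P)) = g (int n)"
    unfolding eventually_periodic_both_def eventually_periodic_def by blast
  from assms obtain N' P' where NP': "P' \<ge> 1" "\<And>n. n \<ge> N' \<Longrightarrow> g (- int (n + P')) = g (- int n)"
    unfolding eventually_periodic_both_def eventually_periodic_def by blast
  let ?b = "max N N'"
  have "g (int (n + k * P)) = g (int n)" if "n \<ge> N" for n k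
    using that by (induction k) (use NP(2)[of "n + _ * P"] in \<open>auto simp: algebra_simps\<close>)
  then have "g (m + int (P' * P)) = g m" if "m \<ge> int ?b" for m
  proof -
    have "N \<le> nat m" "int (nat m) = m" using that by auto
    with \<open>\<And>n k. N \<le> n \<Longrightarrow> g (int (n + k * P)) = g (int n)\<close>[of "nat m" P']
    show ?thesis by simp
  qed
  moreover have "g (- int (n + k * P')) = g (- int n)" if "n \<ge> N'" for n k
    using that by (induction k) (use NP'(2)[of "n + _ * P'"] in \<open>auto simp: algebra_simps\<close>)
  then have "g (m - int (P' * P)) = g m" if "m \<le> - int ?b" for m
  proof -
    have "N' \<le> nat (- m)" "int (nat (- m)) = - m" using that by auto
    with \<open>\<And>n k. N' \<le> n \<Longrightarrow> g (- int (n + k * P')) = g (- int n)\<close>[of "nat (- m)" P]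
    show ?thesis by (simp add: algebra_simps)
  qed
  ultimately have "periodic_beyond (P' * P) ?b g" by (auto simp: periodic_beyond_def)
  then show ?thesis using NP NP' by (intro exI[of _ "P' * P"]) auto
qed

lemma periodic_beyond_common:
  fixes d :: nat
  assumes "\<And>i. i < d \<Longrightarrow> eventually_periodic_both (R i)"
  shows "\<exists>P\<ge>1. \<exists>b. \<forall>i<d. periodic_beyond P b (R i)"
proof -
  from assms periodic_beyond_if_eventually_periodic_both
  have "\<exists>P b. i < d \<longrightarrow> P \<ge> 1 \<and> periodic_beyond P b (R i)" for i by blast
  then obtain P b where Pb: "\<And>i. i < d \<Longrightarrow> P i \<ge> (1::nat) \<and> periodic_beyond (P i) (b i) (R i)"
    by metis
  have "periodic_beyond (prod P {..<d}) (sum b {..<d}) (R i)" if "i < d" for i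
  proof (rule periodic_beyond_mono)
    show "periodic_beyond (P i) (b i) (R i)" using Pb[OF that] by blast
    show "P i dvd prod P {..<d}" using that by (intro dvd_prodI) auto
    show "b i \<le> sum b {..<d}" using that by (intro member_le_sum) auto
  qed
  moreover have "prod P {..<d} \<ge> 1" using Pb by (intro prod_ge_1) simp
  ultimately show ?thesis by blast
qed

text \<open>In a pair \<open>(n, m)\<close>, \<open>n\<close> is the time and \<open>m\<close> the
  position. Period, number of rows and threshold are uniform parameters, so that the set is finite
  and stability under decimation becomes a statement about three numbers.\<close>

definition periodic_rows :: "nat \<Rightarrow> nat \<Rightarrow> nat \<Rightarrow> (int \<times> int \<Rightarrow> 'a::zero) set" where
  "periodic_rows P d b = {N. (\<forall>n m. n < 0 \<or> n > int d \<longrightarrow> N (n, m) = 0) \<and>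
     (\<forall>n. periodic_beyond P b (\<lambda>m. N (n, m)))}"

text \<open>Such an array is determined by its values on a finite box: a position outside the box
  moves towards 0 by steps of \<open>P\<close> without changing the value.\<close>

lemma finite_periodic_rows:
  assumes "P \<ge> 1"
  shows "finite (periodic_rows P d b :: (int \<times> int \<Rightarrow> 'a::{zero,finite}) set)"
proof -
  let ?Q = "{0..int d} \<times> {-int (b + P)..int (b + P)}"
  have "inj_on (\<lambda>N. restrict N ?Q) (periodic_rows P d b :: (int \<times> int \<Rightarrow> 'a) set)"
  proof (rule inj_onI, rule ext)
    fix N M :: "int \<times> int \<Rightarrow> 'a" and v
    assume N: "N \<in> periodic_rows P d b" and M: "M \<in> periodic_rows P d b"
      and eq: "restrict N ?Q = restrict M ?Q"
    have box: "N w = M w" if "w \<in> ?Q" for w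
      using fun_cong[OF eq, of w] that by simp
    have "N (n, m) = M (n, m)" if n: "n \<in> {0..int d}" for n m
    proof (induction "nat \<bar>m\<bar>" arbitrary: m rule: less_induct)
      case less
      show ?case
      proof (cases "(n, m) \<in> ?Q")
        case False
        then consider "m > int (b + P)" | "m < - int (b + P)" using n by force
        then show ?thesis
        proof cases
          case 1
          then have "N (n, (m - int P) + int P) = N (n, m - int P)"
            "M (n, (m - int P) + int P) = M (n, m - int P)"
            using N M unfolding periodic_rows_def periodic_beyond_def mem_Collect_eq by (metis le_diff_eq less_le of_nat_add)+
          moreover have "N (n, m - int P) = M (n, m - int P)"
            using 1 assms by (intro less) auto
          ultimately show ?thesis by simp
        next
          case 2
          then have "m + int P \<le> - int b" by simp
          then have "N (n, (m + int P) - int P) = N (n, m + int P)"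
            "M (n, (m + int P) - int P) = M (n, m + int P)"
            using N M unfolding periodic_rows_def periodic_beyond_def mem_Collect_eq by blast+
          moreover have "N (n, m + int P) = M (n, m + int P)"
            using 2 assms by (intro less) auto
          ultimately show ?thesis by simp
        qed
      qed (use box in blast)
    qed
    then show "N v = M v"
      using N M by (cases v; cases "fst v \<in> {0..int d}") (auto simp: periodic_rows_def periodic_beyond_def not_le)
  qed
  moreover have "finite ((\<lambda>N. restrict N ?Q) ` (periodic_rows P d b :: (int \<times> int \<Rightarrow> 'a) set))"
  proof (rule finite_subset)
    show "(\<lambda>N. restrict N ?Q) ` periodic_rows P d b \<subseteq> PiE ?Q (\<lambda>_. UNIV :: 'a set)"
      by (intro image_subsetI restrict_PiE_iff[THEN iffD2]) simp
    show "finite (PiE ?Q (\<lambda>_. UNIV :: 'a set))" by (intro finite_PiE) simp_all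
  qed
  ultimately show ?thesis by (simp add: finite_image_iff)
qed

text \<open>A key \<open>(i, j)\<close> delays by \<open>i\<close>, between 0 and \<open>d\<close>,
  and moves sideways by at most \<open>J\<close>. So the row range grows by \<open>d\<close> and the
  threshold by \<open>J\<close>, while the period stays.\<close>

lemma act_periodic_rows:
  assumes N: "N \<in> periodic_rows P a b"
    and keys: "Poly_Mapping.keys D \<subseteq> {0..int d} \<times> {-int J..int J}"
  shows "act D N \<in> periodic_rows P (a + d) (b + J)"
proof -
  have sup: "act D N (n, m) = (\<Sum>(i, j)\<in>Poly_Mapping.keys D. Poly_Mapping.lookup D (i, j) * N (n - i, m - j))"
    for n m by (auto simp: act_def intro!: sum.cong)
  have k: "0 \<le> i" "i \<le> int d" "-int J \<le> j" "j \<le> int J" if "(i, j) \<in> Poly_Mapping.keys D" for i j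
    using keys that by auto
  have N': "n < 0 \<or> n > int a \<Longrightarrow> N (n, m) = 0"
    "m \<ge> int b \<Longrightarrow> N (n, m + int P) = N (n, m)" "m \<le> -int b \<Longrightarrow> N (n, m - int P) = N (n, m)" for n m
    using N by (auto simp: periodic_rows_def periodic_beyond_def)
  show ?thesis
    unfolding periodic_rows_def periodic_beyond_def
  proof (intro CollectI conjI allI impI)
    fix n m :: int assume "n < 0 \<or> n > int (a + d)"
    then show "act D N (n, m) = 0"
      unfolding sup
    proof (intro sum.neutral ballI, clarify)
      fix i j assume "(i, j) \<in> Poly_Mapping.keys D"
      from k[OF this] \<open>n < 0 \<or> n > int (a + d)\<close> have "n - i < 0 \<or> n - i > int a" by auto
      then show "Poly_Mapping.lookup D (i, j) * N (n - i, m - j) = 0"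
        by (simp add: N'(1))
    qed
  next
    fix n m assume m: "int (b + J) \<le> m"
    show "act D N (n, m + int P) = act D N (n, m)"
      unfolding sup
    proof (intro sum.cong refl, clarify)
      fix i j assume "(i, j) \<in> Poly_Mapping.keys D"
      then show "Poly_Mapping.lookup D (i, j) * N (n - i, m + int P - j) =
          Poly_Mapping.lookup D (i, j) * N (n - i, m - j)"
        using N'(2)[of "m - j" "n - i"] k[of i j] m by (simp add: algebra_simps)
    qed
  next
    fix n m assume m: "m \<le> - int (b + J)"
    show "act D N (n, m - int P) = act D N (n, m)"
      unfolding sup
    proof (intro sum.cong refl, clarify)
      fix i j assume "(i, j) \<in> Poly_Mapping.keys D"
      then show "Poly_Mapping.lookup D (i, j) * N (n - i, m - int P - j) =
          Poly_Mapping.lookup D (i, j) * N (n - i, m - j)"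
        using N'(3)[of "m - j" "n - i"] k[of i j] m by (simp add: algebra_simps)
    qed
  qed
qed

lemma act_funpow_periodic_rows:
  assumes "N \<in> periodic_rows P a b"
    and "Poly_Mapping.keys D \<subseteq> {0..int d} \<times> {-int J..int J}"
  shows "(act D ^^ k) N \<in> periodic_rows P (a + k * d) (b + k * J)"
proof (induction k)
  case (Suc k)
  then show ?case using act_periodic_rows[OF Suc assms(2)] by (simp add: algebra_simps)
qed (use assms in simp)

text \<open>A Cartier operator in two variables. Only the residue in time varies; positions are
  sampled at multiples of \<open>p\<close>, so column 0 of the result is a decimation of column
  0.\<close>

definition cartier2 :: "nat \<Rightarrow> nat \<Rightarrow> (int \<times> int \<Rightarrow> 'a) \<Rightarrow> int \<times> int \<Rightarrow> 'a" where
  "cartier2 p r G = (\<lambda>(n, m). G (int p * n + int r, int p * m))"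

text \<open>Sampling divides the bounds on time and position by \<open>p\<close>. The period does
  not grow either: each row also has period \<open>p * P\<close>, which sampling turns into
  \<open>P\<close>.\<close>

lemma cartier2_periodic_rows:
  assumes "N \<in> periodic_rows P (p * d) (p * b)" "r < p"
  shows "cartier2 p r N \<in> periodic_rows P d b"
proof -
  have per: "periodic_beyond (p * P) (p * b) (\<lambda>m. N (n, m))" for n
    using assms(1) by (auto simp: periodic_rows_def intro: periodic_beyond_mult)
  show ?thesis
    unfolding periodic_rows_def periodic_beyond_def
  proof (intro CollectI conjI allI impI)
    fix n m :: int assume "n < 0 \<or> n > int d"
    then have "int p * n + int r < 0 \<or> int p * n + int r > int (p * d)"
    proof
      assume "n < 0"
      then have "int p * n \<le> int p * (-1)" by (intro mult_left_mono) auto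
      then show ?thesis using assms by simp
    next
      assume "n > int d"
      then have "int p * n > int p * int d" using assms by (intro mult_strict_left_mono) auto
      then show ?thesis by simp
    qed
    then show "cartier2 p r N (n, m) = 0"
      using assms(1) by (auto simp: cartier2_def periodic_rows_def periodic_beyond_def)
  next
    fix n m :: int assume "int b \<le> m"
    then have "int p * m \<ge> int (p * b)" by (simp add: mult_left_mono)
    with per show "cartier2 p r N (n, m + int P) = cartier2 p r N (n, m)"
      by (simp add: cartier2_def periodic_beyond_def distrib_left)
  next
    fix n m :: int assume "m \<le> - int b"
    then have "int p * m \<le> int p * - int b" by (intro mult_left_mono) auto
    then have "int p * m \<le> - int (p * b)" by simp
    with per show "cartier2 p r N (n, m - int P) = cartier2 p r N (n, m)"
      by (simp add: cartier2_def periodic_beyond_def right_diff_distrib)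
  qed
qed


lemma periodic_rows_mono:
  assumes "N \<in> periodic_rows P d b" "b \<le> b'"
  shows "N \<in> periodic_rows P d b'"
  using assms by (auto simp: periodic_rows_def intro: periodic_beyond_mono)

subsection \<open>Finite kernels\<close>

lemma base_digits_Cons:
  assumes "k \<ge> 2" "r < k" "n > 0 \<or> r > 0"
  shows "base_digits k (k * n + r) = r # base_digits k n"
  using assms by (subst base_digits.simps) auto

text \<open>The sequences in \<open>S\<close> serve as states: reading the digit \<open>r\<close>
  passes to the subsequence along \<open>k * n + r\<close>, and the output is the term at 0, which
  is what remains once all digits are read.\<close>

lemma automatic_if_finite_kernel:
  fixes u :: "nat \<Rightarrow> 'a::finite"
  assumes "k \<ge> 2" "finite S" "u \<in> S"
    and closed: "\<And>v r. v \<in> S \<Longrightarrow> r < k \<Longrightarrow> (\<lambda>n. v (k * n + r)) \<in> S"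
  shows "automatic k UNIV u"
proof -
  define M where "M = \<lparr>states = S, trans = (\<lambda>v r n. v (k * n + r)), start = u, out = (\<lambda>v. v 0)\<rparr>"
  have "v n = foldl (trans M) v (base_digits k n) 0" for v n
  proof (induction n arbitrary: v rule: less_induct)
    case (less n)
    show ?case
    proof (cases "n = 0")
      case False
      then have "base_digits k n = n mod k # base_digits k (n div k)"
        using assms(1) by (simp add: base_digits.simps[of k n])
      then show ?thesis using less[of "n div k" "trans M v (n mod k)"] False assms(1)
        by (simp add: M_def)
    qed (simp add: base_digits.simps)
  qed
  then have "generates k M u" by (simp add: generates_def M_def)
  moreover have "is_dfao k UNIV M" using assms by (auto simp: is_dfao_def M_def)
  ultimately show ?thesis using assms(1) by (intro automaticI)
qed

lemma finite_kernel_if_automatic: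
  fixes u :: "nat \<Rightarrow> 'a::finite"
  assumes "automatic k UNIV u"
  obtains S where "finite S" "u \<in> S"
    "\<And>v r. v \<in> S \<Longrightarrow> r < k \<Longrightarrow> (\<lambda>n. v (k * n + r)) \<in> S"
proof -
  from assms obtain M :: "(nat, 'a) dfao" where k: "k \<ge> 2" and M: "is_dfao k UNIV M" "generates k M u"
    by (auto simp: automatic_def)
  \<comment> \<open>The value at 0 is a free parameter because 0 has no digits: for
    \<open>r = 0\<close> the term at \<open>k * 0 + 0\<close> is the output at \<open>s\<close>
    itself, not the output after reading a digit 0. With finitely many values, the set
    \<open>S\<close> stays finite.\<close>
  define v where "v s a n = (if n = 0 then a else out M (foldl (trans M) s (base_digits k n)))" for s a n
  define S where "S = (\<lambda>(s, a). v s a) ` (states M \<times> UNIV)"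
  show ?thesis
  proof
    show "finite S" using M by (auto simp: S_def is_dfao_def)
    have "u = v (start M) (u 0)" using M by (auto simp: generates_def v_def)
    moreover have "start M \<in> states M" using M by (simp add: is_dfao_def)
    ultimately show "u \<in> S" unfolding S_def by (intro image_eqI[of _ _ "(start M, u 0)"]) auto
    fix w r assume "w \<in> S" "r < k"
    then obtain s a where sa: "s \<in> states M" "w = v s a" by (auto simp: S_def)
    have "(\<lambda>n. w (k * n + r)) = v (trans M s r) (w r)"
      using base_digits_Cons[OF k \<open>r < k\<close>] base_digits_Cons[OF k \<open>r < k\<close>, of 0] k by (auto simp: sa v_def fun_eq_iff)
    moreover have "trans M s r \<in> states M" using M sa \<open>r < k\<close> by (auto simp: is_dfao_def)
    ultimately show "(\<lambda>n. w (k * n + r)) \<in> S"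
      unfolding S_def by (intro image_eqI[of _ _ "(trans M s r, w r)"]) auto
  qed
qed

subsection \<open>Columns of linear cellular automata are automatic\<close>

text \<open>Apart from \<open>(0, 0)\<close>, all shifts in \<open>W\<close> go to strictly earlier
  times, so \<open>c\<close> encodes a recurrence in time. The kernel is bounded by a finite set of
  arrays that is closed under decimation.\<close>

lemma column_automatic:
  fixes G :: "int \<times> int \<Rightarrow> 'a::finite_field"
    and c :: "int \<times> int \<Rightarrow> 'a"
  defines "p \<equiv> CHAR('a)"
  assumes W: "finite W" "W \<subseteq> insert (0, 0) ({1..int d} \<times> {-int J..int J})" "(0, 0) \<in> W"
    and c: "c (0, 0) = 1"
    and G0: "\<And>n m. n < 0 \<Longrightarrow> G (n, m) = 0"
    and GN: "(\<lambda>v. \<Sum>w\<in>W. c w * G (v - w)) \<in> periodic_rows P d b"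
    and P: "P \<ge> 1" and J: "J \<le> b"
  shows "automatic p UNIV (\<lambda>n. G (int n, 0))"
proof -
  have p: "prime p" "p \<ge> 2" unfolding p_def using prime_ge_2_nat by blast+
  \<comment> \<open>\<open>D k\<close> is the operator after \<open>k\<close> decimations, each of
    which raises the coefficients to the \<open>p\<close>-th power.\<close>
  define D where "D k = (\<Sum>w\<in>W. Poly_Mapping.single w (c w ^ (p ^ k)))" for k
  have act_D: "act (D k) H v = (\<Sum>w\<in>W. c w ^ (p ^ k) * H (v - w))" for k H v
    by (simp add: D_def act_sum act_single)
  define Z where "Z = {H :: int \<times> int \<Rightarrow> 'a. \<forall>n m. n < 0 \<longrightarrow> H (n, m) = 0}"
  have keys_D: "Poly_Mapping.keys (D k) \<subseteq> {0..int d} \<times> {-int J..int J}" for k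
  proof -
    have "Poly_Mapping.keys (D k) \<subseteq> W"
      unfolding D_def using keys_sum[of "\<lambda>w. Poly_Mapping.single w (c w ^ (p ^ k))" W]
      by (auto split: if_splits)
    then show ?thesis using W by auto
  qed
  \<comment> \<open>The operator is unitriangular in time: its coefficient at \<open>(0, 0)\<close>
    is 1 and all other keys look strictly back. Vanishing at negative times starts the
    induction.\<close>
  have inj: "inj_on (act (D k)) Z" for k
  proof (rule inj_onI, rule ext)
    fix H H' :: "int \<times> int \<Rightarrow> 'a" and v
    assume H: "H \<in> Z" "H' \<in> Z" and eq: "act (D k) H = act (D k) H'"
    have "H (n, m) = H' (n, m)" for n m
    proof (induction "nat n" arbitrary: n m rule: less_induct)
      case less
      show ?case
      proof (cases "n < 0")
        case False
        have split: "act (D k) F (n, m) = F (n, m) + (\<Sum>w\<in>W - {(0, 0)}. c w ^ (p ^ k) * F ((n, m) - w))" for F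
          unfolding act_D using W c by (subst sum.remove[of W "(0, 0)"]) (auto simp: minus_prod_def)
        have "(\<Sum>w\<in>W - {(0, 0)}. c w ^ (p ^ k) * H ((n, m) - w)) = (\<Sum>w\<in>W - {(0, 0)}. c w ^ (p ^ k) * H' ((n, m) - w))"
        proof (intro sum.cong refl)
          fix w assume w: "w \<in> W - {(0, 0)}"
          then have "1 \<le> fst w" using W by auto
          then have "H (n - fst w, m - snd w) = H' (n - fst w, m - snd w)"
            using False H less[of "n - fst w" "m - snd w"] by (cases "n - fst w < 0") (auto simp: Z_def)
          then show "c w ^ (p ^ k) * H ((n, m) - w) = c w ^ (p ^ k) * H' ((n, m) - w)"
            by (cases w) simp
        qed
        then show ?thesis using fun_cong[OF eq, of "(n, m)"] unfolding split by simp
      qed (use H in \<open>auto simp: Z_def\<close>)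
    qed
    then show "H v = H' v" by (cases v) simp
  qed
  \<comment> \<open>The twist \<open>k\<close> depends on the array, but Frobenius has finite order
    on the field, so only finitely many operators \<open>D k\<close> occur. Each is injective on
    \<open>Z\<close> and thus contributes finitely many arrays.\<close>
  define K where "K = {H \<in> Z. \<exists>k. act (D k) H \<in> periodic_rows P d b}"
  have "finite K"
  proof -
    obtain e where e: "e > 0" "\<And>x :: 'a. x ^ (p ^ e) = x"
      using finite_field_power_CHAR_ex unfolding p_def by blast
    have pe: "x ^ (p ^ (k * e)) = x" for x :: 'a and k
      by (induction k) (simp_all add: power_add power_mult e)
    have D_mod: "D k = D (k mod e)" for k
    proof -
      have "x ^ (p ^ k) = x ^ (p ^ (k mod e))" for x :: 'a
        using pe[of x "k div e"] by (metis div_mult_mod_eq power_add power_mult)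
      then show ?thesis by (simp add: D_def)
    qed
    have "K \<subseteq> (\<Union>k<e. (act (D k) -` periodic_rows P d b) \<inter> Z)"
    proof
      fix H assume "H \<in> K"
      then obtain k where "H \<in> Z" "act (D k) H \<in> periodic_rows P d b" by (auto simp: K_def)
      then show "H \<in> (\<Union>k<e. (act (D k) -` periodic_rows P d b) \<inter> Z)"
        using e(1) D_mod[of k] by (intro UN_I[of "k mod e"]) auto
    qed
    moreover have "finite ((act (D k) -` periodic_rows P d b) \<inter> Z)" for k
      by (intro finite_vimage_IntI finite_periodic_rows P inj)
    ultimately show ?thesis by (meson finite_UN_I finite_lessThan finite_subset)
  qed
  have closed: "cartier2 p r H \<in> K" if H: "H \<in> K" and r: "r < p" for H r
  proof -
    from H obtain k where k: "H \<in> Z" "act (D k) H \<in> periodic_rows P d b" by (auto simp: K_def)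
    define N where "N = act (D k) H"
    have shift: "((+) w ^^ n) 0 = (int n * fst w, int n * snd w)" for w :: "int \<times> int" and n
      by (induction n) (auto simp: prod_eq_iff algebra_simps)
    \<comment> \<open>By the freshman's dream, the \<open>p\<close>-th power has the coefficients of
      \<open>D (Suc k)\<close>, with all keys multiplied by \<open>p\<close>.\<close>
    have "D k ^ p = (\<Sum>w\<in>W. Poly_Mapping.single w (c w ^ (p ^ k)) ^ p)"
      unfolding D_def by (rule freshmans_dream_sum) (auto simp: CHAR_poly_mapping p_def)
    then have Dp: "act (D k ^ p) H v = (\<Sum>w\<in>W. c w ^ (p ^ Suc k) * H (v - (int p * fst w, int p * snd w)))" for v
      by (simp add: act_sum act_single single_power shift power_Suc2 del: power_Suc flip: power_mult)
    have "D k ^ p = D k ^ (p - 1) * D k"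
      using p power_minus_mult[of p "D k"] by simp
    then have "act (D k ^ p) H = (act (D k) ^^ (p - 1)) N"
      unfolding N_def act_power[symmetric] by (intro ext) (metis act_mult)
    also have "\<dots> \<in> periodic_rows P (d + (p - 1) * d) (b + (p - 1) * J)"
      using k keys_D unfolding N_def by (intro act_funpow_periodic_rows)
    also have "d + (p - 1) * d = p * d" using p by (cases p) auto
    \<comment> \<open>The remaining \<open>p - 1\<close> factors of \<open>D k\<close> enlarge the
      bounds from \<open>d\<close> to \<open>p * d\<close> and, as \<open>J \<le> b\<close>, from
      \<open>b\<close> to at most \<open>p * b\<close>: exactly what decimation can undo.\<close>
    finally have "act (D k ^ p) H \<in> periodic_rows P (p * d) (p * b)"
    proof (rule periodic_rows_mono)
      have "b + (p - 1) * J \<le> b + (p - 1) * b" using J by simp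
      also have "\<dots> = p * b" using p by (cases p) auto
      finally show "b + (p - 1) * J \<le> p * b" .
    qed
    then have "cartier2 p r (act (D k ^ p) H) \<in> periodic_rows P d b"
      using r by (rule cartier2_periodic_rows)
    also have "cartier2 p r (act (D k ^ p) H) = act (D (Suc k)) (cartier2 p r H)"
    proof
      fix v :: "int \<times> int"
      \<comment> \<open>A translation by a multiple \<open>p * w\<close> becomes the translation by
        \<open>w\<close> after sampling.\<close>
      have "(int p * fst v + int r, int p * snd v) - (int p * fst w, int p * snd w) =
          (int p * fst (v - w) + int r, int p * snd (v - w))" for w
        by (simp add: right_diff_distrib)
      then show "cartier2 p r (act (D k ^ p) H) v = act (D (Suc k)) (cartier2 p r H) v"
        by (simp only: cartier2_def act_D Dp split_def)
    qed
    finally have "act (D (Suc k)) (cartier2 p r H) \<in> periodic_rows P d b" .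
    moreover have "cartier2 p r H \<in> Z"
      unfolding Z_def cartier2_def
    proof (clarsimp)
      fix n m :: int assume "n < 0"
      then have "int p * n \<le> int p * (-1)" by (intro mult_left_mono) auto
      then show "H (int p * n + int r, int p * m) = 0" using k(1) r by (simp add: Z_def)
    qed
    ultimately show ?thesis unfolding K_def by blast
  qed
  show ?thesis
  proof (rule automatic_if_finite_kernel[where S = "(\<lambda>H n. H (int n, 0)) ` K"])
    show "finite ((\<lambda>H n. H (int n, 0)) ` K)" using \<open>finite K\<close> by simp
    have "act (D 0) G = (\<lambda>v. \<Sum>w\<in>W. c w * G (v - w))" by (simp add: fun_eq_iff act_D)
    then have "act (D 0) G \<in> periodic_rows P d b" using GN by simp
    then have "G \<in> K" using G0 unfolding K_def Z_def by blast
    then show "(\<lambda>n. G (int n, 0)) \<in> (\<lambda>H n. H (int n, 0)) ` K" by blast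
  next
    fix v :: "nat \<Rightarrow> 'a" and r assume "v \<in> (\<lambda>H n. H (int n, 0)) ` K" "r < p"
    then obtain H where "H \<in> K" "v = (\<lambda>n. H (int n, 0))" by blast
    then show "(\<lambda>n. v (p * n + r)) \<in> (\<lambda>H n. H (int n, 0)) ` K"
      using closed[OF \<open>H \<in> K\<close> \<open>r < p\<close>] by (intro image_eqI[of _ _ "cartier2 p r H"]) (auto simp: cartier2_def)
  qed (fact p(2))
qed

text \<open>Padding the coefficients by zeros gives one radius \<open>J\<close> for both
  sides.\<close>

lemma linear_cellular_automaton_symmetric:
  fixes \<Phi> :: "(int \<Rightarrow> nat \<Rightarrow> 'a :: field) \<Rightarrow> int \<Rightarrow> 'a"
  assumes "linear_cellular_automaton d \<Phi>"
  obtains J :: nat and f where "\<And>X m. \<Phi> (join_configs d X) m = (\<Sum>i<d. \<Sum>j=-int J..int J. f j i * X i (m + j))"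
proof -
  from assms obtain l r :: nat and f where
    f: "\<And>X m. X \<in> topspace (configs (tuples d)) \<Longrightarrow> \<Phi> X m = (\<Sum>i<d. \<Sum>j=-int l..int r. f j i * X (m + j) i)"
    unfolding linear_cellular_automaton_iff by blast
  define F where "F j i = (if j \<in> {-int l..int r} then f j i else 0)" for j i
  have "\<Phi> (join_configs d X) m = (\<Sum>i<d. \<Sum>j=-int (max l r)..int (max l r). F j i * X i (m + j))" for X m
  proof -
    have "join_configs d X \<in> topspace (configs (tuples d))"
      by (simp add: topspace_configs join_configs_def)
    from f[OF this, of m] have "\<Phi> (join_configs d X) m = (\<Sum>i<d. \<Sum>j=-int l..int r. F j i * X i (m + j))"
      by (simp add: join_configs_def F_def)
    also have "\<dots> = (\<Sum>i<d. \<Sum>j=-int (max l r)..int (max l r). F j i * X i (m + j))"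
      by (intro sum.cong refl sum.mono_neutral_left) (auto simp: F_def)
    finally show ?thesis .
  qed
  then show ?thesis using that by blast
qed

theorem column_of_linear_cellular_automaton_automatic:
  fixes \<Phi> :: "(int \<Rightarrow> nat \<Rightarrow> 'a :: finite_field) \<Rightarrow> int \<Rightarrow> 'a"
  assumes \<Phi>: "linear_cellular_automaton d \<Phi>"
    and R: "\<And>i. i < d \<Longrightarrow> eventually_periodic_both (R i)"
  shows "automatic CHAR('a) UNIV (\<lambda>n. spacetime_diagram d \<Phi> R n m)"
proof -
  obtain J :: nat and f where f: "\<And>X m. \<Phi> (join_configs d X) m = (\<Sum>i<d. \<Sum>j=-int J..int J. f j i * X i (m + j))"
    by (rule linear_cellular_automaton_symmetric[OF \<Phi>]) (rule that)
  obtain P b where Pb: "P \<ge> 1" "\<And>i. i < d \<Longrightarrow> periodic_beyond P b (R i)"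
    using periodic_beyond_common[of d R, OF R] by blast
  \<comment> \<open>The diagram is translated so that the column \<open>m\<close> becomes column 0,
    and extended by zero to negative times.\<close>
  define G where "G = (\<lambda>(n, k). if n < 0 then 0 else spacetime_diagram d \<Phi> R (nat n) (m + k))"
  define W where "W = insert (0, 0) ({1..int d} \<times> {-int J..int J})"
  \<comment> \<open>A delay by \<open>i\<close> refers to the argument of index \<open>d - i\<close>
    of the local rule; the space index is reflected because arrays are evaluated at
    \<open>v - w\<close>.\<close>
  define c where "c = (\<lambda>(i, j). if i = 0 then 1 else - f (-j) (nat (int d - i)))"
  have W: "finite W" "W \<subseteq> insert (0, 0) ({1..int d} \<times> {-int J..int J})" "(0, 0) \<in> W"
    by (auto simp: W_def)
  define N where "N F v = (\<Sum>w\<in>W. c w * F (v - w))" for F v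
  have N: "N F (n, k) = F (n, k) - (\<Sum>i<d. \<Sum>j=-int J..int J. f j i * F (n - int d + int i, k + j))" for F n k
  proof -
    have "N F (n, k) = F (n, k) + (\<Sum>w\<in>{1..int d} \<times> {-int J..int J}. c w * F ((n, k) - w))"
      unfolding N_def W_def by (subst sum.insert) (auto simp: c_def)
    also have "(\<Sum>w\<in>{1..int d} \<times> {-int J..int J}. c w * F ((n, k) - w))
      = (\<Sum>(i, j)\<in>{..<d} \<times> {-int J..int J}. - (f j i * F (n - int d + int i, k + j)))"
      by (rule sum.reindex_bij_witness[of _ "\<lambda>(i, j). (int d - int i, - j)" "\<lambda>(i, j). (nat (int d - i), - j)"])
        (auto simp: c_def algebra_simps)
    finally show ?thesis by (simp add: sum_negf flip: sum.cartesian_product)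
  qed
  define G0 where "G0 = (\<lambda>(n, k). if n < int d then G (n, k) else 0)"
  have G0: "G0 \<in> periodic_rows P d (b + nat \<bar>m\<bar>)"
    unfolding periodic_rows_def
  proof (intro CollectI conjI allI impI)
    show "G0 (n, k) = 0" if "n < 0 \<or> n > int d" for n k
      using that by (auto simp: G0_def G_def)
    show "periodic_beyond P (b + nat \<bar>m\<bar>) (\<lambda>k. G0 (n, k))" for n
    proof (cases "0 \<le> n \<and> n < int d")
      case True
      then have "G0 (n, k) = R (nat n) (m + k)" for k
        by (auto simp: G0_def G_def spacetime_diagram.simps[of d \<Phi> R "nat n"])
      moreover have "periodic_beyond P b (R (nat n))" using True Pb by auto
      ultimately show ?thesis using periodic_beyond_shift by simp
    qed (auto simp: G0_def G_def periodic_beyond_def)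
  qed
  \<comment> \<open>\<open>N\<close> only sees times up to the present one: on rows below
    \<open>d\<close> it depends on the initial rows alone, and from row \<open>d\<close> on the
    recurrence makes it vanish.\<close>
  have NG: "N G (n, k) = (if 0 \<le> n \<and> n < int d then N G0 (n, k) else 0)" for n k
  proof -
    consider "n < 0" | "0 \<le> n" "n < int d" | "n \<ge> int d" by linarith
    then show ?thesis
    proof cases
      case 1
      then show ?thesis unfolding N by (auto simp: G_def intro!: sum.neutral)
    next
      case 2
      then show ?thesis unfolding N by (auto simp: G0_def intro!: sum.cong)
    next
      case 3
      then have "nat (n - int d + int i) = nat n - d + i" for i by auto
      moreover have "G (n, k) = \<Phi> (join_configs d (\<lambda>i. spacetime_diagram d \<Phi> R (nat n - d + i))) (m + k)"
      proof -
        have "\<not> nat n < d" "\<not> n < 0" using 3 by auto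
        then show ?thesis
          unfolding G_def by (simp only: spacetime_diagram.simps[of d \<Phi> R "nat n"] split if_False)
      qed
      ultimately have "G (n, k) = (\<Sum>i<d. \<Sum>j=-int J..int J. f j i * G (n - int d + int i, k + j))"
        using 3 unfolding f by (simp add: G_def add.assoc)
      then show ?thesis using 3 by (simp add: N)
    qed
  qed
  \<comment> \<open>The rows from \<open>d\<close> to \<open>d + d\<close> are cut off again in
    \<open>N G\<close>.\<close>
  have "N G0 \<in> periodic_rows P (d + d) (b + nat \<bar>m\<bar> + J)"
  proof -
    define D where "D = (\<Sum>w\<in>W. Poly_Mapping.single w (c w))"
    have "Poly_Mapping.keys D \<subseteq> W"
      unfolding D_def using keys_sum[of "\<lambda>w. Poly_Mapping.single w (c w)" W]
      by (auto split: if_splits)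
    then have "Poly_Mapping.keys D \<subseteq> {0..int d} \<times> {-int J..int J}" by (auto simp: W_def)
    moreover have "N G0 = act D G0" by (simp add: fun_eq_iff N_def D_def act_sum act_single)
    ultimately show ?thesis using act_periodic_rows[OF G0] by metis
  qed
  then have "N G \<in> periodic_rows P d (b + nat \<bar>m\<bar> + J)"
    unfolding periodic_rows_def mem_Collect_eq by (auto simp: NG periodic_beyond_def)
  then have "automatic CHAR('a) UNIV (\<lambda>n. G (int n, 0))"
    unfolding N_def using Pb(1) by (intro column_automatic[OF W]) (auto simp: c_def G_def)
  then show ?thesis by (simp add: G_def)
qed

subsection \<open>Ore relations\<close>

text \<open>This passes from the characteristic to a power \<open>Q\<close> whose Frobenius fixes
  the field. The low digits \<open>r mod k ^ e\<close> are removed first, then the top digit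
  \<open>r div k ^ e\<close>.\<close>

lemma finite_kernel_power:
  fixes S :: "(nat \<Rightarrow> 'a) set"
  assumes closed: "\<And>v r. v \<in> S \<Longrightarrow> r < k \<Longrightarrow> (\<lambda>n. v (k * n + r)) \<in> S"
    and "v \<in> S" "r < k ^ e"
  shows "(\<lambda>n. v (k ^ e * n + r)) \<in> S"
  using assms(2,3)
proof (induction e arbitrary: v r)
  case (Suc e)
  have k: "k ^ e > 0" using Suc.prems by (cases "k = 0") auto
  have "(\<lambda>n. v (k ^ e * n + r mod k ^ e)) \<in> S"
    using Suc k by auto
  moreover have "r div k ^ e < k"
    using Suc.prems by (simp add: less_mult_imp_div_less)
  ultimately have "(\<lambda>n. v (k ^ e * (k * n + r div k ^ e) + r mod k ^ e)) \<in> S"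
    using closed by force
  then show ?case by (simp add: algebra_simps)
qed simp

text \<open>In other words, \<open>f^Q = f(t^Q)\<close>. Writing \<open>f = f(0) + t g\<close> gives
  \<open>f^Q = f(0) + t^Q g^Q\<close>, and the induction continues with \<open>g\<close> at an index
  smaller by \<open>Q\<close>.\<close>

lemma fps_CHAR_power_nth:
  fixes f :: "'a::{comm_ring_1} fps"
  assumes CHAR: "prime CHAR('a)" and Q: "Q = CHAR('a) ^ e" and frob: "\<And>x :: 'a. x ^ Q = x"
  shows "(f ^ Q) $ n = (if Q dvd n then f $ (n div Q) else 0)"
proof (induction n arbitrary: f rule: less_induct)
  case (less n)
  have Q0: "Q > 0" using Q prime_gt_0_nat[OF CHAR] by simp
  have "f = fps_const (f $ 0) + fps_X * fps_shift 1 f"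
    by (simp add: fps_eq_iff fps_X_mult_nth)
  then have "f ^ Q = (fps_const (f $ 0) + fps_X * fps_shift 1 f) ^ Q"
    by simp
  also have "\<dots> = fps_const (f $ 0) ^ Q + (fps_X * fps_shift 1 f) ^ Q"
    by (rule freshmans_dream'[of _ e]) (use assms in auto)
  also have "\<dots> = fps_const (f $ 0) + fps_X ^ Q * fps_shift 1 f ^ Q"
    by (simp add: fps_const_power frob power_mult_distrib)
  finally have eq: "(f ^ Q) $ n = (if n = 0 then f $ 0 else 0) + (if n < Q then 0 else (fps_shift 1 f ^ Q) $ (n - Q))"
    by (simp add: fps_X_power_mult_nth)
  show ?case
  proof (cases "n < Q")
    case True
    then show ?thesis unfolding eq by (auto dest: dvd_imp_le)
  next
    case False
    then have "n > 0" "n \<ge> Q" using Q0 by auto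
    then have "n div Q = Suc ((n - Q) div Q)" using Q0 by (simp add: le_div_geq)
    then show ?thesis
      using \<open>n > 0\<close> \<open>n \<ge> Q\<close> Q0 unfolding eq by (subst less) (auto simp: dvd_minus_self)
  qed
qed

definition cartier :: "nat \<Rightarrow> nat \<Rightarrow> 'a::zero poly \<Rightarrow> 'a poly" where
  "cartier Q r c = Abs_poly (\<lambda>n. coeff c (Q * n + r))"

lemma coeff_cartier:
  assumes "Q > 0"
  shows "coeff (cartier Q r c) n = coeff c (Q * n + r)"
proof -
  have "coeff c (Q * i + r) = 0" if "degree c < i" for i
  proof -
    have "1 * i \<le> Q * i" using assms by (intro mult_le_mono1) simp
    then have "degree c < Q * i + r" using that by linarith
    then show ?thesis by (rule coeff_eq_0)
  qed
  then show ?thesis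
    using coeff_Abs_poly[of "degree c" "\<lambda>n. coeff c (Q * n + r)"] by (simp add: cartier_def)
qed

text \<open>Since \<open>g^Q = g(t^Q)\<close> has exponents divisible by \<open>Q\<close> only,
  extracting a residue class of exponents affects \<open>c\<close> alone and takes the
  \<open>Q\<close>-th root of the other factor.\<close>

lemma cartier_mult_power_nth:
  fixes g :: "'a::{comm_ring_1} fps"
  assumes CHAR: "prime CHAR('a)" and Q: "Q = CHAR('a) ^ e" and frob: "\<And>x :: 'a. x ^ Q = x"
    and r: "r < Q"
  shows "(fps_of_poly c * g ^ Q) $ (Q * n + r) = (fps_of_poly (cartier Q r c) * g) $ n"
proof -
  have Q0: "Q > 0" using r by simp
  have "(fps_of_poly c * g ^ Q) $ (Q * n + r)
      = (\<Sum>i=0..Q * n + r. coeff c i * (if Q dvd Q * n + r - i then g $ ((Q * n + r - i) div Q) else 0))"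
    by (simp add: fps_mult_nth fps_CHAR_power_nth[OF CHAR Q frob])
  also have "\<dots> = (\<Sum>i\<in>(\<lambda>k. Q * k + r) ` {0..n}.
      coeff c i * (if Q dvd Q * n + r - i then g $ ((Q * n + r - i) div Q) else 0))"
  proof (rule sum.mono_neutral_right)
    show "\<forall>i\<in>{0..Q * n + r} - (\<lambda>k. Q * k + r) ` {0..n}.
      coeff c i * (if Q dvd Q * n + r - i then g $ ((Q * n + r - i) div Q) else 0) = 0"
    proof
      fix i assume i: "i \<in> {0..Q * n + r} - (\<lambda>k. Q * k + r) ` {0..n}"
      have "\<not> Q dvd Q * n + r - i"
      proof
        assume "Q dvd Q * n + r - i"
        then obtain l where l: "Q * n + r - i = Q * l" by blast
        have "Q * l < Q * Suc n" using l r by simp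
        then have "l \<le> n" using Q0 by (simp only: nat_mult_less_cancel_disj less_Suc_eq_le)
        then have "Q * (n - l) = Q * n - Q * l" "Q * l \<le> Q * n" by (auto simp: diff_mult_distrib2)
        then have "i = Q * (n - l) + r" using l i by auto
        then show False using i by auto
      qed
      then show "coeff c i * (if Q dvd Q * n + r - i then g $ ((Q * n + r - i) div Q) else 0) = 0"
        by simp
    qed
  qed auto
  also have "\<dots> = (\<Sum>k=0..n. coeff c (Q * k + r) * g $ (n - k))"
    using Q0 by (subst sum.reindex) (auto simp: inj_on_def diff_mult_distrib2[symmetric] intro!: sum.cong)
  also have "\<dots> = (fps_of_poly (cartier Q r c) * g) $ n"
    by (simp add: fps_mult_nth coeff_cartier[OF Q0])
  finally show ?thesis .
qed

text \<open>Fraction-free Gaussian elimination, with equations indexed by \<open>S\<close> and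
  unknowns by \<open>J\<close>.\<close>

lemma homogeneous_system_nontrivial_solution:
  fixes M :: "'j \<Rightarrow> 's \<Rightarrow> 'a::idom"
  assumes "finite S" "finite J" "card S < card J"
  shows "\<exists>c. (\<exists>j\<in>J. c j \<noteq> 0) \<and> (\<forall>s\<in>S. (\<Sum>j\<in>J. c j * M j s) = 0)"
  using assms
proof (induction S arbitrary: J M rule: finite_induct)
  case empty
  then have "J \<noteq> {}" by auto
  then show ?case by (intro exI[of _ "\<lambda>_. 1"]) auto
next
  case (insert s S)
  show ?case
  proof (cases "\<forall>j\<in>J. M j s = 0")
    case True
    have "card S < card J" using insert by simp
    then obtain c where "\<exists>j\<in>J. c j \<noteq> 0" "\<forall>t\<in>S. (\<Sum>j\<in>J. c j * M j t) = 0"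
      using insert.IH[OF insert.prems(1), of M] by blast
    then show ?thesis using True by (intro exI[of _ c]) auto
  next
    case False
    then obtain i where i: "i \<in> J" "M i s \<noteq> 0" by blast
    \<comment> \<open>Cross-multiplication with the pivot \<open>M i s\<close> eliminates the
      unknown \<open>i\<close> and makes equation \<open>s\<close> trivial.\<close>
    define M' where "M' j t = M i s * M j t - M j s * M i t" for j t
    have "card S < card (J - {i})" using insert i by simp
    then obtain c' where c': "\<exists>j\<in>J - {i}. c' j \<noteq> 0" "\<forall>t\<in>S. (\<Sum>j\<in>J - {i}. c' j * M' j t) = 0"
      using insert.IH[of "J - {i}" M'] insert.prems(1) by blast
    \<comment> \<open>Multiplying the reduced solution by the pivot allows equation \<open>s\<close>
      to be solved for the unknown \<open>i\<close> without division.\<close>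
    define c where "c j = (if j = i then - (\<Sum>j\<in>J - {i}. c' j * M j s) else c' j * M i s)" for j
    have "(\<Sum>j\<in>J. c j * M j t) = (\<Sum>j\<in>J - {i}. c' j * M' j t)" for t
    proof -
      have "(\<Sum>j\<in>J. c j * M j t) = c i * M i t + (\<Sum>j\<in>J - {i}. c j * M j t)"
        using i insert by (simp add: sum.remove)
      also have "(\<Sum>j\<in>J - {i}. c j * M j t) = (\<Sum>j\<in>J - {i}. c' j * M i s * M j t)"
        by (intro sum.cong) (auto simp: c_def)
      also have "c i * M i t + \<dots> = (\<Sum>j\<in>J - {i}. c' j * M' j t)"
        by (simp add: c_def M'_def sum_distrib_left sum_distrib_right sum_subtractf algebra_simps)
      finally show ?thesis .
    qed
    moreover have "M' j s = 0" for j by (simp add: M'_def)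
    ultimately have "\<forall>t\<in>insert s S. (\<Sum>j\<in>J. c j * M j t) = 0" using c' by simp
    moreover have "\<exists>j\<in>J. c j \<noteq> 0" using c' i by (auto simp: c_def)
    ultimately show ?thesis by blast
  qed
qed

text \<open>Sorting exponents by residue gives \<open>v = \<Sum>r<Q. t^r w_r(t^Q)\<close>, where
  \<open>w_r(t^Q)\<close> is the \<open>Q\<close>-th power of the section \<open>w_r\<close>. The
  polynomial \<open>a s\<close> collects the \<open>t^r\<close> of all residues whose section is
  \<open>s\<close>.\<close>

lemma fps_eq_sum_kernel_powers:
  fixes v :: "nat \<Rightarrow> 'a::{comm_ring_1}"
  assumes CHAR: "prime CHAR('a)" and Q: "Q = CHAR('a) ^ e" and frob: "\<And>x :: 'a. x ^ Q = x"
    and S: "finite S" "\<And>r. r < Q \<Longrightarrow> (\<lambda>n. v (Q * n + r)) \<in> S"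
  shows "\<exists>a. Abs_fps v = (\<Sum>s\<in>S. fps_of_poly (a s) * Abs_fps s ^ Q)"
proof -
  have Q0: "Q > 0" using Q prime_gt_0_nat[OF CHAR] by simp
  define w where "w = (\<lambda>r n. v (Q * n + r))"
  define a where "a s = (\<Sum>r | r < Q \<and> w r = s. monom (1 :: 'a) r)" for s
  have "(\<Sum>s\<in>S. fps_of_poly (a s) * Abs_fps s ^ Q)
      = (\<Sum>s\<in>S. \<Sum>r | r \<in> {..<Q} \<and> w r = s. fps_X ^ r * Abs_fps (w r) ^ Q)"
    by (auto simp: a_def fps_of_poly_sum fps_of_poly_monom' sum_distrib_right intro!: sum.cong)
  also have "\<dots> = (\<Sum>r<Q. fps_X ^ r * Abs_fps (w r) ^ Q)"
    using S by (intro sum.group) (auto simp: w_def)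
  also have "\<dots> = Abs_fps v"
  proof (rule fps_ext)
    fix n
    have "(\<Sum>r<Q. fps_X ^ r * Abs_fps (w r) ^ Q) $ n
        = (\<Sum>r<Q. if r \<le> n \<and> Q dvd n - r then w r ((n - r) div Q) else 0)"
      unfolding fps_sum_nth
      by (intro sum.cong) (auto simp: fps_X_power_mult_nth fps_CHAR_power_nth[OF CHAR Q frob])
    also have "\<dots> = (\<Sum>r<Q. if r = n mod Q then v n else 0)"
    proof (intro sum.cong refl)
      fix r assume r: "r \<in> {..<Q}"
      show "(if r \<le> n \<and> Q dvd n - r then w r ((n - r) div Q) else 0) = (if r = n mod Q then v n else 0)"
      proof (cases "r = n mod Q")
        case True
        have "n - n mod Q = Q * (n div Q)" by (simp add: minus_mod_eq_mult_div)
        then show ?thesis using True Q0 by (simp add: w_def)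
      next
        case False
        then have "\<not> (r \<le> n \<and> Q dvd n - r)"
          using r by (metis lessThan_iff mod_eq_dvd_iff_nat mod_less)
        with False show ?thesis by (simp only: if_False)
      qed
    qed
    also have "\<dots> = v n" using Q0 by simp
    finally show "(\<Sum>r<Q. fps_X ^ r * Abs_fps (w r) ^ Q) $ n = Abs_fps v $ n" by simp
  qed
  finally show ?thesis by metis
qed

text \<open>With \<open>K = card S\<close>, the \<open>K + 1\<close> series \<open>y^(Q^j)\<close>,
  \<open>j \<le> K\<close>, all lie in the span over the polynomials of the \<open>K\<close> series
  \<open>s^(Q^K)\<close>, so they are dependent.\<close>

lemma Ore_relation_if_finite_kernel:
  fixes u :: "nat \<Rightarrow> 'a::idom"
  assumes CHAR: "prime CHAR('a)" and Q: "Q = CHAR('a) ^ e" and frob: "\<And>x :: 'a. x ^ Q = x"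
    and S: "finite S" "u \<in> S" "\<And>v r. v \<in> S \<Longrightarrow> r < Q \<Longrightarrow> (\<lambda>n. v (Q * n + r)) \<in> S"
  shows "\<exists>K c. (\<exists>j\<le>K. c j \<noteq> 0) \<and> (\<Sum>j\<le>K. fps_of_poly (c j) * Abs_fps u ^ (Q ^ j)) = 0"
proof -
  have Qk: "Q ^ k = CHAR('a fps) ^ (e * k)" for k by (simp add: Q power_mult)
  have CHAR': "prime CHAR('a fps)" using CHAR by simp
  have "\<forall>v\<in>S. \<exists>a. Abs_fps v = (\<Sum>s\<in>S. fps_of_poly (a s) * Abs_fps s ^ Q)"
    using fps_eq_sum_kernel_powers[OF CHAR Q frob S(1)] S(3) by blast
  then obtain a where a: "\<And>v. v \<in> S \<Longrightarrow> Abs_fps v = (\<Sum>s\<in>S. fps_of_poly (a v s) * Abs_fps s ^ Q)"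
    by metis
  have span: "\<exists>b. Abs_fps u = (\<Sum>s\<in>S. fps_of_poly (b s) * Abs_fps s ^ (Q ^ k))" for k
  proof (induction k)
    case 0
    show ?case
      by (rule exI[of _ "\<lambda>s. if s = u then 1 else 0"])
        (use S in \<open>simp add: if_distrib[of fps_of_poly] if_distrib[of "\<lambda>x. x * _"] cong: if_cong\<close>)
  next
    case (Suc k)
    then obtain b where b: "Abs_fps u = (\<Sum>s\<in>S. fps_of_poly (b s) * Abs_fps s ^ (Q ^ k))" by blast
    have "Abs_fps s ^ (Q ^ k) = (\<Sum>t\<in>S. fps_of_poly (a s t ^ (Q ^ k)) * Abs_fps t ^ (Q ^ Suc k))"
      if "s \<in> S" for s
    proof -
      have "Abs_fps s ^ (Q ^ k) = (\<Sum>t\<in>S. fps_of_poly (a s t) * Abs_fps t ^ Q) ^ (Q ^ k)"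
        using a[OF that] by simp
      also have "\<dots> = (\<Sum>t\<in>S. (fps_of_poly (a s t) * Abs_fps t ^ Q) ^ (Q ^ k))"
        by (rule freshmans_dream_sum'[OF CHAR' Qk])
      finally show ?thesis
        by (simp add: power_mult_distrib fps_of_poly_power power_mult)
    qed
    then have "Abs_fps u = (\<Sum>s\<in>S. \<Sum>t\<in>S. fps_of_poly (b s * a s t ^ (Q ^ k)) * Abs_fps t ^ (Q ^ Suc k))"
      by (subst b) (simp add: sum_distrib_left fps_of_poly_mult mult.assoc cong: sum.cong)
    also have "\<dots> = (\<Sum>t\<in>S. fps_of_poly (\<Sum>s\<in>S. b s * a s t ^ (Q ^ k)) * Abs_fps t ^ (Q ^ Suc k))"
      by (subst sum.swap) (simp add: fps_of_poly_sum sum_distrib_right)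
    finally show ?case
      by (intro exI[of _ "\<lambda>t. \<Sum>s\<in>S. b s * a s t ^ (Q ^ k)"])
  qed
  define K where "K = card S"
  \<comment> \<open>Raising the expansion of level \<open>K - j\<close> to the power
    \<open>Q^j\<close> reaches the common level \<open>K\<close>.\<close>
  have "\<exists>b. Abs_fps u ^ (Q ^ j) = (\<Sum>s\<in>S. fps_of_poly (b s) * Abs_fps s ^ (Q ^ K))" if "j \<le> K" for j
  proof -
    obtain b where b: "Abs_fps u = (\<Sum>s\<in>S. fps_of_poly (b s) * Abs_fps s ^ (Q ^ (K - j)))"
      using span by blast
    have "Abs_fps u ^ (Q ^ j) = (\<Sum>s\<in>S. (fps_of_poly (b s) * Abs_fps s ^ (Q ^ (K - j))) ^ (Q ^ j))"
      by (subst b) (rule freshmans_dream_sum'[OF CHAR' Qk])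
    also have "\<dots> = (\<Sum>s\<in>S. fps_of_poly (b s ^ (Q ^ j)) * Abs_fps s ^ (Q ^ K))"
      using that by (simp add: power_mult_distrib fps_of_poly_power flip: power_mult power_add)
    finally show ?thesis by (intro exI[of _ "\<lambda>s. b s ^ (Q ^ j)"])
  qed
  then obtain b where b: "\<And>j. j \<le> K \<Longrightarrow> Abs_fps u ^ (Q ^ j) = (\<Sum>s\<in>S. fps_of_poly (b j s) * Abs_fps s ^ (Q ^ K))"
    by metis
  have "card S < card {..K}" by (simp add: K_def)
  then obtain c where c: "\<exists>j\<in>{..K}. c j \<noteq> 0" "\<forall>s\<in>S. (\<Sum>j\<le>K. c j * b j s) = 0"
    using homogeneous_system_nontrivial_solution[of S "{..K}" b] S by auto
  have "(\<Sum>j\<le>K. fps_of_poly (c j) * Abs_fps u ^ (Q ^ j))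
      = (\<Sum>j\<le>K. \<Sum>s\<in>S. fps_of_poly (c j * b j s) * Abs_fps s ^ (Q ^ K))"
    by (intro sum.cong) (auto simp: b sum_distrib_left fps_of_poly_mult mult.assoc)
  also have "\<dots> = (\<Sum>s\<in>S. fps_of_poly (\<Sum>j\<le>K. c j * b j s) * Abs_fps s ^ (Q ^ K))"
    by (subst sum.swap) (simp add: fps_of_poly_sum sum_distrib_right)
  also have "\<dots> = 0" using c by simp
  finally show ?thesis using c by blast
qed

text \<open>If \<open>c 0 = 0\<close>, then every remaining term is a polynomial times a
  \<open>Q\<close>-th power. A Cartier operator takes the root and yields a shorter
  relation.\<close>

lemma separable_Ore_relation:
  fixes y :: "'a::idom fps"
  assumes CHAR: "prime CHAR('a)" and Q: "Q = CHAR('a) ^ e" and frob: "\<And>x :: 'a. x ^ Q = x"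
    and "\<exists>j\<le>K. c j \<noteq> 0" "(\<Sum>j\<le>K. fps_of_poly (c j) * y ^ (Q ^ j)) = 0"
  shows "\<exists>K c. c 0 \<noteq> 0 \<and> (\<Sum>j\<le>K. fps_of_poly (c j) * y ^ (Q ^ j)) = 0"
  using assms(4,5)
proof (induction K arbitrary: c)
  case (Suc K)
  show ?case
  proof (cases "c 0 = 0")
    case True
    have Q0: "Q > 0" using Q prime_gt_0_nat[OF CHAR] by simp
    obtain j where "j \<le> Suc K" "c j \<noteq> 0" using Suc.prems by blast
    with True obtain i where i: "i \<le> K" "c (Suc i) \<noteq> 0" by (cases j) auto
    then obtain m where m: "coeff (c (Suc i)) m \<noteq> 0" by (auto simp: poly_eq_iff)
    \<comment> \<open>This residue keeps a nonzero coefficient of \<open>c (Suc i)\<close>, so the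
      shorter relation is not trivial.\<close>
    define r where "r = m mod Q"
    have r: "r < Q" using Q0 by (simp add: r_def)
    have "(\<Sum>j\<le>K. fps_of_poly (cartier Q r (c (Suc j))) * y ^ (Q ^ j)) = 0"
    proof (rule fps_ext)
      fix n
      have "(\<Sum>j\<le>K. fps_of_poly (cartier Q r (c (Suc j))) * y ^ (Q ^ j)) $ n
          = (\<Sum>j\<le>K. (fps_of_poly (c (Suc j)) * (y ^ (Q ^ j)) ^ Q) $ (Q * n + r))"
        by (simp add: fps_sum_nth cartier_mult_power_nth[OF CHAR Q frob r])
      also have "\<dots> = (\<Sum>j\<le>K. fps_of_poly (c (Suc j)) * y ^ (Q ^ Suc j)) $ (Q * n + r)"
        by (simp add: fps_sum_nth mult.commute flip: power_mult)
      also have "(\<Sum>j\<le>K. fps_of_poly (c (Suc j)) * y ^ (Q ^ Suc j)) = 0"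
        using Suc.prems(2) True by (simp add: sum.atMost_Suc_shift del: sum.atMost_Suc)
      finally show "(\<Sum>j\<le>K. fps_of_poly (cartier Q r (c (Suc j))) * y ^ (Q ^ j)) $ n = 0 $ n" by simp
    qed
    moreover have "coeff (cartier Q r (c (Suc i))) (m div Q) \<noteq> 0"
      using m Q0 by (simp add: coeff_cartier r_def)
    then have "\<exists>j\<le>K. cartier Q r (c (Suc j)) \<noteq> 0"
      using i by (intro exI[of _ i]) auto
    ultimately show ?thesis using Suc.IH[of "\<lambda>j. cartier Q r (c (Suc j))"] by blast
  qed (use Suc in blast)
next
  case 0
  then have "c 0 \<noteq> 0" by simp
  show ?case
    by (rule exI[of _ 0], rule exI[of _ c]) (intro conjI \<open>c 0 \<noteq> 0\<close> 0(2))
qed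

lemma monom_factor_coeff_0_nonzero:
  fixes c :: "'a::idom poly"
  assumes "c \<noteq> 0"
  obtains a A where "c = monom 1 a * A" "coeff A 0 \<noteq> 0"
proof -
  define a where "a = (LEAST i. coeff c i \<noteq> 0)"
  have "\<exists>i. coeff c i \<noteq> 0" using assms by (auto simp: poly_eq_iff)
  then have a: "coeff c a \<noteq> 0" unfolding a_def by (rule LeastI_ex)
  have "coeff c i = 0" if "i < a" for i
    using that not_less_Least unfolding a_def by blast
  then have "monom 1 a dvd c" by (simp add: monom_1_dvd_iff')
  then obtain A where A: "c = monom 1 a * A" by blast
  then have "coeff c a = coeff A 0" by (simp add: coeff_monom_mult)
  with A a that show ?thesis by simp
qed

text \<open>Substituting \<open>y = T + t^k z\<close> multiplies the term \<open>j\<close> by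
  \<open>t^(k Q^j)\<close>. For large \<open>k\<close> the linear term has the lowest order, and
  dividing by that power of \<open>t\<close> leaves it alone at \<open>t = 0\<close>.\<close>

lemma Ore_relation_normal_form:
  fixes y :: "'a::idom fps"
  assumes CHAR: "prime CHAR('a)" and Q: "Q = CHAR('a) ^ e" "Q \<ge> 2"
    and "c 0 \<noteq> 0" and rel: "(\<Sum>j\<le>K. fps_of_poly (c j) * y ^ (Q ^ j)) = 0"
  obtains k T z A C B where "y = fps_of_poly T + fps_X ^ k * z" "z $ 0 = 0" "coeff A 0 \<noteq> 0"
    "\<And>j. coeff (C j) 0 = 0" "coeff B 0 = 0"
    "fps_of_poly A * z + (\<Sum>j=1..K. fps_of_poly (C j) * z ^ (Q ^ j)) + fps_of_poly B = 0"
proof -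
  obtain a A where A: "c 0 = monom 1 a * A" "coeff A 0 \<noteq> 0"
    using monom_factor_coeff_0_nonzero[OF \<open>c 0 \<noteq> 0\<close>] by blast
  \<comment> \<open>With \<open>a\<close> the order of \<open>c 0\<close> at 0, the linear term has
    the factor \<open>t^(a + k)\<close>, and \<open>k = a + 1\<close> suffices:
    \<open>k Q^j \<ge> 2 k > a + k\<close>.\<close>
  define k where "k = Suc a"
  \<comment> \<open>The coefficient at \<open>k\<close> itself is included, so that \<open>z\<close>
    has constant term 0.\<close>
  define T where "T = Abs_poly (\<lambda>i. if i \<le> k then y $ i else 0)"
  have T: "coeff T i = (if i \<le> k then y $ i else 0)" for i
    by (simp add: T_def coeff_Abs_poly_If_le)
  define z where "z = fps_shift k (y - fps_of_poly T)"
  have y: "y = fps_of_poly T + fps_X ^ k * z"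
    by (auto simp: fps_eq_iff z_def fps_X_power_mult_nth T)
  have z0: "z $ 0 = 0" by (simp add: z_def T)
  have ge: "k * Q ^ j > a + k" if "j \<ge> 1" for j
  proof -
    have "2 \<le> Q ^ j" using Q(2) that self_le_power[of Q j] by simp
    then have "k * 2 \<le> k * Q ^ j" by (intro mult_le_mono2)
    then show ?thesis by (simp add: k_def)
  qed
  \<comment> \<open>The value at \<open>j = 0\<close> lies outside the sum; 0 makes the vanishing at
    \<open>t = 0\<close> hold for all \<open>j\<close>.\<close>
  define C where "C j = (if j = 0 then 0 else c j * monom 1 (k * Q ^ j - (a + k)))" for j
  define L where "L = fps_of_poly A * z + (\<Sum>j=1..K. fps_of_poly (C j) * z ^ (Q ^ j))"
  define U where "U = (\<Sum>j\<le>K. c j * T ^ (Q ^ j))"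
  have "y ^ (Q ^ j) = fps_of_poly T ^ (Q ^ j) + fps_X ^ (k * Q ^ j) * z ^ (Q ^ j)" for j
  proof -
    have "y ^ (Q ^ j) = (fps_of_poly T + fps_X ^ k * z) ^ (Q ^ j)" using y by simp
    also have "\<dots> = fps_of_poly T ^ (Q ^ j) + (fps_X ^ k * z) ^ (Q ^ j)"
      by (rule freshmans_dream'[of _ "e * j"]) (use CHAR Q in \<open>auto simp: power_mult\<close>)
    finally show ?thesis by (simp add: power_mult_distrib flip: power_mult)
  qed
  then have "0 = fps_of_poly U + (\<Sum>j\<le>K. fps_of_poly (c j) * (fps_X ^ (k * Q ^ j) * z ^ (Q ^ j)))"
    using rel by (simp add: U_def fps_of_poly_sum fps_of_poly_mult fps_of_poly_power distrib_left sum.distrib)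
  also have "(\<Sum>j\<le>K. fps_of_poly (c j) * (fps_X ^ (k * Q ^ j) * z ^ (Q ^ j)))
      = fps_of_poly (c 0) * (fps_X ^ k * z) + (\<Sum>j=1..K. fps_of_poly (c j) * (fps_X ^ (k * Q ^ j) * z ^ (Q ^ j)))"
    by (simp add: sum.atLeast1_atMost_eq sum.atMost_shift lessThan_Suc_atMost)
  also have "\<dots> = fps_X ^ (a + k) * L"
  proof -
    have "fps_of_poly (c j) * (fps_X ^ (k * Q ^ j) * z ^ (Q ^ j)) = fps_X ^ (a + k) * (fps_of_poly (C j) * z ^ (Q ^ j))"
      if "j \<in> {1..K}" for j
    proof -
      have "fps_X ^ (k * Q ^ j) = (fps_X ^ (a + k) * fps_X ^ (k * Q ^ j - (a + k)) :: 'a fps)"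
        using ge[of j] that by (simp flip: power_add)
      then show ?thesis
        using that by (simp add: C_def fps_of_poly_mult fps_of_poly_monom' mult_ac)
    qed
    then have "(\<Sum>j=1..K. fps_of_poly (c j) * (fps_X ^ (k * Q ^ j) * z ^ (Q ^ j)))
        = (\<Sum>j=1..K. fps_X ^ (a + k) * (fps_of_poly (C j) * z ^ (Q ^ j)))"
      by (rule sum.cong[OF refl])
    then show ?thesis
      by (simp only:) (simp add: L_def A fps_of_poly_mult fps_of_poly_monom' distrib_left sum_distrib_left power_add mult_ac)
  qed
  finally have UL: "fps_of_poly U + fps_X ^ (a + k) * L = 0" by simp
  define B where "B = poly_shift (a + k) U"
  \<comment> \<open>The polynomial \<open>U\<close> equals \<open>- t^(a + k) L\<close>, so shifting
    its coefficients down by \<open>a + k\<close> is an exact division.\<close>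
  have "fps_of_poly B = fps_shift (a + k) (- (fps_X ^ (a + k) * L))"
    using UL by (simp add: B_def add_eq_0_iff2)
  then have LB: "L + fps_of_poly B = 0"
    by (simp add: fps_eq_iff fps_X_power_mult_nth)
  have C0: "coeff (C j) 0 = 0" for j
    using ge[of j] by (cases "j = 0") (auto simp: C_def coeff_mult)
  then have "L $ 0 = 0"
    using z0 by (simp add: L_def fps_sum_nth)
  then have "coeff B 0 = 0" using arg_cong[OF LB, of "\<lambda>f. f $ 0"] by simp
  with C0 show ?thesis
    using that[OF y z0 A(2), of C B] LB by (simp add: L_def)
qed

subsection \<open>Rational series and cellular automata\<close>

definition laurent_polynomial :: "'a::zero fls \<Rightarrow> bool" where
  "laurent_polynomial g \<longleftrightarrow> finite {m. fls_nth g m \<noteq> 0}"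

lemma laurent_polynomial_simps [simp, intro]:
  "laurent_polynomial 0" "laurent_polynomial 1" "laurent_polynomial (fls_const c)"
  by (auto simp: laurent_polynomial_def)

lemma laurent_polynomial_add [intro]:
  fixes g h :: "'a::monoid_add fls"
  assumes "laurent_polynomial g" "laurent_polynomial h"
  shows "laurent_polynomial (g + h)"
  unfolding laurent_polynomial_def
  by (rule finite_subset[of _ "{m. fls_nth g m \<noteq> 0} \<union> {m. fls_nth h m \<noteq> 0}"])
    (use assms in \<open>auto simp: laurent_polynomial_def\<close>)

lemma laurent_polynomial_uminus [intro]:
  fixes g :: "'a::group_add fls"
  shows "laurent_polynomial g \<Longrightarrow> laurent_polynomial (- g)"
  by (simp add: laurent_polynomial_def)

lemma laurent_polynomial_sum [intro]:
  fixes g :: "'i \<Rightarrow> 'a::comm_monoid_add fls"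
  assumes "\<And>i. i \<in> A \<Longrightarrow> laurent_polynomial (g i)"
  shows "laurent_polynomial (sum g A)"
  using assms by (induction A rule: infinite_finite_induct) auto

lemma laurent_polynomial_shift [intro]:
  assumes "laurent_polynomial g"
  shows "laurent_polynomial (fls_shift i g)"
  unfolding laurent_polynomial_def
  by (rule finite_subset[of _ "(\<lambda>m. m - i) ` {m. fls_nth g m \<noteq> 0}"])
    (use assms in \<open>auto simp: laurent_polynomial_def intro!: image_eqI[of _ _ "_ + i"]\<close>)

lemma fls_times_nth_support:
  fixes g h :: "'a::comm_ring_1 fls"
  assumes "finite M" "{s. fls_nth g s \<noteq> 0} \<subseteq> M"
  shows "fls_nth (g * h) m = (\<Sum>s\<in>M. fls_nth g s * fls_nth h (m - s))"
proof -
  have "g = (\<Sum>s\<in>M. fls_const (fls_nth g s) * fls_X_intpow s)"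
    using assms by (auto simp: fls_eq_iff fls_nth_sum fls_X_intpow_times_conv_shift)
  then have "g * h = (\<Sum>s\<in>M. fls_const (fls_nth g s) * fls_X_intpow s) * h"
    by simp
  also have "\<dots> = (\<Sum>s\<in>M. fls_const (fls_nth g s) * fls_shift (- s) h)"
    by (simp only: sum_distrib_right mult.assoc fls_X_intpow_times_conv_shift(1))
  finally show ?thesis by (simp add: fls_nth_sum)
qed

lemma laurent_polynomial_mult [intro]:
  fixes g h :: "'a::comm_ring_1 fls"
  assumes "laurent_polynomial g" "laurent_polynomial h"
  shows "laurent_polynomial (g * h)"
proof -
  let ?G = "{m. fls_nth g m \<noteq> 0}" and ?H = "{m. fls_nth h m \<noteq> 0}"
  have "{m. fls_nth (g * h) m \<noteq> 0} \<subseteq> (\<lambda>(s, t). s + t) ` (?G \<times> ?H)"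
  proof
    fix m assume "m \<in> {m. fls_nth (g * h) m \<noteq> 0}"
    then have "(\<Sum>s\<in>?G. fls_nth g s * fls_nth h (m - s)) \<noteq> 0"
      using assms fls_times_nth_support[of ?G g h m] by (auto simp: laurent_polynomial_def)
    then obtain s where "s \<in> ?G" "fls_nth g s * fls_nth h (m - s) \<noteq> 0"
      by (meson sum.neutral)
    then show "m \<in> (\<lambda>(s, t). s + t) ` (?G \<times> ?H)"
      by (intro image_eqI[of _ _ "(s, m - s)"]) auto
  qed
  then show ?thesis
    using assms unfolding laurent_polynomial_def by (meson finite_SigmaI finite_imageI finite_subset)
qed

lemma laurent_polynomial_bounded:
  assumes "laurent_polynomial g"
  shows "\<exists>J::nat. \<forall>m. \<bar>m\<bar> > int J \<longrightarrow> fls_nth g m = 0"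
proof -
  have "finite ((\<lambda>m. nat \<bar>m\<bar>) ` {m. fls_nth g m \<noteq> 0})"
    using assms by (simp add: laurent_polynomial_def)
  then obtain J where J: "\<forall>x\<in>(\<lambda>m. nat \<bar>m\<bar>) ` {m. fls_nth g m \<noteq> 0}. x \<le> J"
    using finite_nat_set_iff_bounded_le by blast
  have "fls_nth g m = 0" if "\<bar>m\<bar> > int J" for m
  proof (rule ccontr)
    assume "fls_nth g m \<noteq> 0"
    then have "nat \<bar>m\<bar> \<le> J" using J by blast
    then show False using that by linarith
  qed
  then show ?thesis by blast
qed

lemma eventually_periodic_both_laurent_polynomial:
  assumes "laurent_polynomial g"
  shows "eventually_periodic_both (fls_nth g)"
proof -
  from laurent_polynomial_bounded[OF assms] obtain J :: nat
    where J: "\<And>m. \<bar>m\<bar> > int J \<Longrightarrow> fls_nth g m = 0" by blast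
  show ?thesis
    unfolding eventually_periodic_both_def eventually_periodic_def
    by (intro conjI exI[of _ "Suc J"] exI[of _ 1]) (auto simp: J)
qed

lemma range_fps_of_poly_vanish:
  assumes "f \<in> range fps_of_poly"
  shows "\<exists>N. \<forall>n>N. f $ n = 0"
proof -
  from assms obtain c where "f = fps_of_poly c" by blast
  then show ?thesis by (intro exI[of _ "degree c"]) (simp add: coeff_eq_0)
qed

text \<open>Comparing coefficients of \<open>t^n\<close> in \<open>P * V\<close> expresses
  \<open>a x V_n\<close> by earlier rows. Dividing by \<open>a x\<close> is a scaling and a shift,
  so the recurrence is a finite local rule and the rows of \<open>V\<close> have finite
  support.\<close>

lemma linear_cellular_automaton_if_rational:
  fixes P V :: "'a::finite_field fls fps"
  assumes P0: "P $ 0 = fls_const a * fls_X" "a \<noteq> 0"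
    and lp: "\<And>n. laurent_polynomial (P $ n)" "\<And>n. laurent_polynomial ((P * V) $ n)"
    and poly: "P \<in> range fps_of_poly" "P * V \<in> range fps_of_poly"
  shows "\<exists>d \<Phi> R. d \<ge> 1 \<and> linear_cellular_automaton d \<Phi> \<and> (\<forall>i<d. eventually_periodic_both (R i)) \<and>
    (\<forall>n m. spacetime_diagram d \<Phi> R n m = fls_nth (V $ n) m)"
proof -
  have rec0: "fls_const a * (fls_X * V $ n) = (P * V) $ n - (\<Sum>i=1..n. P $ i * V $ (n - i))" for n
    by (simp add: fps_mult_nth sum.atLeast_Suc_atMost P0 mult.assoc)
  have V: "laurent_polynomial (V $ n)" for n
  proof (induction n rule: less_induct)
    case (less n)
    have "V $ n = fls_const (inverse a) * fls_shift 1 (fls_const a * (fls_X * V $ n))"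
      using P0(2) by (simp add: fls_eq_iff fls_X_times_conv_shift)
    then have "V $ n = fls_const (inverse a) * fls_shift 1 ((P * V) $ n + - (\<Sum>i=1..n. P $ i * V $ (n - i)))"
      unfolding rec0 by simp
    moreover have "laurent_polynomial (fls_const (inverse a) * fls_shift 1 ((P * V) $ n + - (\<Sum>i=1..n. P $ i * V $ (n - i))))"
      using lp less by (intro laurent_polynomial_mult laurent_polynomial_shift laurent_polynomial_add
        laurent_polynomial_uminus laurent_polynomial_sum laurent_polynomial_simps) auto
    ultimately show ?case by simp
  qed
  obtain d1 where d1: "\<And>n. n > d1 \<Longrightarrow> P $ n = 0" using range_fps_of_poly_vanish[OF poly(1)] by blast
  obtain d2 where d2: "\<And>n. n > d2 \<Longrightarrow> (P * V) $ n = 0" using range_fps_of_poly_vanish[OF poly(2)] by blast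
  \<comment> \<open>Beyond both degrees, so that the numerator \<open>P * V\<close> no longer
    contributes from time \<open>d\<close> on.\<close>
  define d where "d = Suc (max d1 d2)"
  have "\<forall>n. \<exists>J::nat. \<forall>m. \<bar>m\<bar> > int J \<longrightarrow> fls_nth (P $ n) m = 0"
    using laurent_polynomial_bounded lp(1) by blast
  then obtain Jn :: "nat \<Rightarrow> nat" where Jn: "\<And>n m. \<bar>m\<bar> > int (Jn n) \<Longrightarrow> fls_nth (P $ n) m = 0" by metis
  define J where "J = (\<Sum>n\<le>d. Jn n)"
  have J: "fls_nth (P $ n) m = 0" if "\<bar>m\<bar> > int J" "n \<le> d" for n m
  proof -
    have "Jn n \<le> J" unfolding J_def using that by (intro member_le_sum) auto
    then show ?thesis using that by (intro Jn) auto
  qed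
  \<comment> \<open>The offset 1 comes from the division by \<open>x\<close>. The range from
    \<open>- J\<close> to \<open>J + 1\<close> used below is invariant under the reflection of
    \<open>j\<close> to \<open>1 - j\<close>.\<close>
  define f where "f j i = - inverse a * fls_nth (P $ (d - i)) (1 - j)" for j :: int and i
  have rec: "fls_nth (V $ n) m = (\<Sum>i<d. \<Sum>j=-int J..int (Suc J). f j i * fls_nth (V $ (n - d + i)) (m + j))"
    if n: "n \<ge> d" for n m
  proof -
    have "a * fls_nth (V $ n) m = fls_nth (fls_const a * (fls_X * V $ n)) (m + 1)"
      by (simp add: fls_X_times_conv_shift)
    also have "\<dots> = - (\<Sum>i=1..n. fls_nth (P $ i * V $ (n - i)) (m + 1))"
      unfolding rec0 using d2[of n] n by (simp add: d_def fls_nth_sum)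
    also have "(\<Sum>i=1..n. fls_nth (P $ i * V $ (n - i)) (m + 1)) = (\<Sum>i=1..d. fls_nth (P $ i * V $ (n - i)) (m + 1))"
      using n by (intro sum.mono_neutral_right) (auto simp: d1 d_def)
    also have "\<dots> = (\<Sum>i<d. fls_nth (P $ (d - i) * V $ (n - d + i)) (m + 1))"
      by (rule sum.reindex_bij_witness[of _ "\<lambda>i. d - i" "\<lambda>i. d - i"]) (use n in auto)
    also have "\<dots> = (\<Sum>i<d. \<Sum>j=-int J..int (Suc J). fls_nth (P $ (d - i)) (1 - j) * fls_nth (V $ (n - d + i)) (m + j))"
    proof (intro sum.cong refl)
      fix i assume "i \<in> {..<d}"
      then have "{s. fls_nth (P $ (d - i)) s \<noteq> 0} \<subseteq> {-int J..int (Suc J)}"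
        using J[of _ "d - i"] by (force simp: not_less abs_le_iff)
      then have "fls_nth (P $ (d - i) * V $ (n - d + i)) (m + 1)
          = (\<Sum>s=-int J..int (Suc J). fls_nth (P $ (d - i)) s * fls_nth (V $ (n - d + i)) (m + 1 - s))"
        by (intro fls_times_nth_support) auto
      also have "\<dots> = (\<Sum>j=-int J..int (Suc J). fls_nth (P $ (d - i)) (1 - j) * fls_nth (V $ (n - d + i)) (m + j))"
        by (rule sum.reindex_bij_witness[of _ "\<lambda>j. 1 - j" "\<lambda>j. 1 - j"]) (auto simp: algebra_simps)
      finally show "fls_nth (P $ (d - i) * V $ (n - d + i)) (m + 1)
          = (\<Sum>j=-int J..int (Suc J). fls_nth (P $ (d - i)) (1 - j) * fls_nth (V $ (n - d + i)) (m + j))" .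
    qed
    finally have *: "a * fls_nth (V $ n) m = - (\<Sum>i<d. \<Sum>j=-int J..int (Suc J).
        fls_nth (P $ (d - i)) (1 - j) * fls_nth (V $ (n - d + i)) (m + j))" .
    have "fls_nth (V $ n) m = inverse a * (a * fls_nth (V $ n) m)" using P0(2) by simp
    then show ?thesis
      unfolding * f_def by (simp add: sum_distrib_left sum_negf mult.assoc)
  qed
  define \<Phi> where "\<Phi> X m = (\<Sum>i<d. \<Sum>j=-int J..int (Suc J). f j i * X (m + j) i)" for X :: "int \<Rightarrow> nat \<Rightarrow> 'a" and m
  have "linear_cellular_automaton d \<Phi>"
    unfolding linear_cellular_automaton_iff
  proof (intro conjI exI ballI allI)
    show "1 \<le> d" by (simp add: d_def)
    show "\<Phi> X m = (\<Sum>i<d. \<Sum>j=-int J..int (Suc J). f j i * X (m + j) i)" for X m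
      by (simp only: \<Phi>_def)
  qed simp
  moreover have "spacetime_diagram d \<Phi> (\<lambda>i. fls_nth (V $ i)) n = fls_nth (V $ n)" for n
  proof (induction n rule: less_induct)
    case (less n)
    show ?case
    proof (cases "n < d")
      case False
      have "spacetime_diagram d \<Phi> (\<lambda>i. fls_nth (V $ i)) n
          = \<Phi> (join_configs d (\<lambda>i. spacetime_diagram d \<Phi> (\<lambda>i. fls_nth (V $ i)) (n - d + i)))"
        using False by (simp add: spacetime_diagram.simps[of d \<Phi> _ n])
      also have "join_configs d (\<lambda>i. spacetime_diagram d \<Phi> (\<lambda>i. fls_nth (V $ i)) (n - d + i))
          = join_configs d (\<lambda>i. fls_nth (V $ (n - d + i)))"
        using less False by (intro join_configs_cong) auto
      also have "\<Phi> \<dots> = fls_nth (V $ n)"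
        using rec[of n] False by (auto simp: fun_eq_iff \<Phi>_def join_configs_def)
      finally show ?thesis .
    qed (simp add: spacetime_diagram.simps)
  qed
  ultimately show ?thesis
    using V eventually_periodic_both_laurent_polynomial
    by (intro exI[of _ d] exI[of _ \<Phi>] exI[of _ "\<lambda>i. fls_nth (V $ i)"]) (auto simp: d_def)
qed

text \<open>In \<open>'a fls fps\<close> the power series variable is the time \<open>t\<close> and the Laurent
  variable is the space \<open>x\<close>.\<close>

definition const_fls :: "'a::zero fps \<Rightarrow> 'a fls fps" where
  "const_fls f = Abs_fps (\<lambda>n. fls_const (f $ n))"

lemma const_fls_nth [simp]: "const_fls f $ n = fls_const (f $ n)"
  by (simp add: const_fls_def)

lemma fls_const_sum: "fls_const (sum f A) = (\<Sum>x\<in>A. fls_const (f x :: 'a::comm_monoid_add))"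
  by (simp add: fls_eq_iff fls_nth_sum)

lemma const_fls_hom:
  fixes f g :: "'a::comm_ring_1 fps"
  shows "const_fls (f + g) = const_fls f + const_fls g" "const_fls (f * g) = const_fls f * const_fls g"
    "const_fls (f ^ n) = const_fls f ^ n" "const_fls (0 :: 'a fps) = 0"
    "const_fls (\<Sum>x\<in>A. F x :: 'a fps) = (\<Sum>x\<in>A. const_fls (F x))"
proof -
  show add: "const_fls (f + g) = const_fls f + const_fls g" for f g :: "'a fps"
    by (simp add: fps_eq_iff fls_plus_const)
  show mult: "const_fls (f * g) = const_fls f * const_fls g" for f g :: "'a fps"
    by (simp add: fps_eq_iff fps_mult_nth fls_const_sum fls_const_mult_const)
  have "const_fls (1 :: 'a fps) = 1" by (auto simp: fps_eq_iff)
  then show "const_fls (f ^ n) = const_fls f ^ n"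
    by (induction n) (simp_all add: mult)
  show 0: "const_fls (0 :: 'a fps) = 0" by (simp add: fps_eq_iff)
  show "const_fls (\<Sum>x\<in>A. F x :: 'a fps) = (\<Sum>x\<in>A. const_fls (F x))"
    by (induction A rule: infinite_finite_induct) (simp_all add: 0 add)
qed

lemma const_fls_fps_of_poly: "const_fls (fps_of_poly c) \<in> range fps_of_poly"
  by (rule image_eqI[of _ _ "map_poly fls_const c"]) (auto simp: fps_eq_iff coeff_map_poly)

lemma range_fps_of_poly_closed:
  fixes f g :: "'a::comm_ring_1 fps"
  shows "f \<in> range fps_of_poly \<Longrightarrow> g \<in> range fps_of_poly \<Longrightarrow> f + g \<in> range fps_of_poly"
    "f \<in> range fps_of_poly \<Longrightarrow> g \<in> range fps_of_poly \<Longrightarrow> f * g \<in> range fps_of_poly"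
    "f \<in> range fps_of_poly \<Longrightarrow> f ^ n \<in> range fps_of_poly"
    "fps_X \<in> range (fps_of_poly :: 'a poly \<Rightarrow> _)" "fps_const c \<in> range fps_of_poly"
    "(\<And>x. x \<in> A \<Longrightarrow> F x \<in> range fps_of_poly) \<Longrightarrow> sum F A \<in> range (fps_of_poly :: 'a poly \<Rightarrow> _)"
proof -
  show add: "f \<in> range fps_of_poly \<Longrightarrow> g \<in> range fps_of_poly \<Longrightarrow> f + g \<in> range fps_of_poly" for f g :: "'a fps"
    by (auto simp flip: fps_of_poly_add)
  show "f \<in> range fps_of_poly \<Longrightarrow> g \<in> range fps_of_poly \<Longrightarrow> f * g \<in> range fps_of_poly"
    by (auto simp flip: fps_of_poly_mult)
  show "f \<in> range fps_of_poly \<Longrightarrow> f ^ n \<in> range fps_of_poly"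
    by (auto simp flip: fps_of_poly_power)
  show "fps_X \<in> range (fps_of_poly :: 'a poly \<Rightarrow> _)" by (metis fps_of_poly_fps_X rangeI)
  show "fps_const c \<in> range fps_of_poly" by (metis fps_of_poly_const rangeI)
  have 0: "0 \<in> range (fps_of_poly :: 'a poly \<Rightarrow> _)" by (metis fps_of_poly_0 rangeI)
  show "(\<And>x. x \<in> A \<Longrightarrow> F x \<in> range fps_of_poly) \<Longrightarrow> sum F A \<in> range (fps_of_poly :: 'a poly \<Rightarrow> _)"
    by (induction A rule: infinite_finite_induct) (auto intro: add 0)
qed

section \<open>Series without negative powers of the space variable\<close>

definition regular :: "'a::zero fls fps \<Rightarrow> bool" where
  "regular f \<longleftrightarrow> (\<forall>n. f $ n \<in> range fps_to_fls)"

lemma range_fps_to_fls_closed: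
  fixes g h :: "'a::comm_ring_1 fls"
  shows "g \<in> range fps_to_fls \<Longrightarrow> h \<in> range fps_to_fls \<Longrightarrow> g + h \<in> range fps_to_fls"
    "g \<in> range fps_to_fls \<Longrightarrow> - g \<in> range fps_to_fls"
    "g \<in> range fps_to_fls \<Longrightarrow> h \<in> range fps_to_fls \<Longrightarrow> g * h \<in> range fps_to_fls"
    "fls_const c \<in> range (fps_to_fls :: 'a fps \<Rightarrow> _)" "0 \<in> range (fps_to_fls :: 'a fps \<Rightarrow> _)"
    "fls_X \<in> range (fps_to_fls :: 'a fps \<Rightarrow> _)"
    "(\<And>x. x \<in> A \<Longrightarrow> F x \<in> range fps_to_fls) \<Longrightarrow> sum F A \<in> range (fps_to_fls :: 'a fps \<Rightarrow> _)"
proof -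
  show add: "g \<in> range fps_to_fls \<Longrightarrow> h \<in> range fps_to_fls \<Longrightarrow> g + h \<in> range fps_to_fls" for g h :: "'a fls"
    by (auto simp flip: fps_to_fls_plus)
  show "g \<in> range fps_to_fls \<Longrightarrow> - g \<in> range fps_to_fls"
    by (auto simp flip: fps_to_fls_uminus)
  show "g \<in> range fps_to_fls \<Longrightarrow> h \<in> range fps_to_fls \<Longrightarrow> g * h \<in> range fps_to_fls"
    by (auto simp flip: fls_times_fps_to_fls)
  show "fls_const c \<in> range (fps_to_fls :: 'a fps \<Rightarrow> _)"
    by (rule image_eqI[of _ _ "fps_const c"]) auto
  show 0: "0 \<in> range (fps_to_fls :: 'a fps \<Rightarrow> _)"
    by (rule image_eqI[of _ _ 0]) auto
  show "fls_X \<in> range (fps_to_fls :: 'a fps \<Rightarrow> _)"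
    by (rule image_eqI[of _ _ fps_X]) auto
  show "(\<And>x. x \<in> A \<Longrightarrow> F x \<in> range fps_to_fls) \<Longrightarrow> sum F A \<in> range (fps_to_fls :: 'a fps \<Rightarrow> _)"
    by (induction A rule: infinite_finite_induct) (auto intro: add 0)
qed

lemma regular_closed:
  fixes f g :: "'a::comm_ring_1 fls fps" and c :: "'a fps"
  shows "regular f \<Longrightarrow> regular g \<Longrightarrow> regular (f + g)" "regular f \<Longrightarrow> regular (- f)"
    "regular f \<Longrightarrow> regular g \<Longrightarrow> regular (f * g)" "regular (const_fls c)"
    "regular f \<Longrightarrow> regular (f ^ n)"
    "(\<And>x. x \<in> A \<Longrightarrow> regular (F x)) \<Longrightarrow> regular (sum F A :: 'a fls fps)"
proof -
  show add: "regular f \<Longrightarrow> regular g \<Longrightarrow> regular (f + g)" for f g :: "'a fls fps"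
    by (simp add: regular_def range_fps_to_fls_closed)
  show "regular f \<Longrightarrow> regular (- f)"
    by (simp add: regular_def range_fps_to_fls_closed)
  show mult: "regular f \<Longrightarrow> regular g \<Longrightarrow> regular (f * g)" for f g :: "'a fls fps"
    by (simp add: regular_def fps_mult_nth range_fps_to_fls_closed)
  show const: "regular (const_fls c)" for c :: "'a fps"
    by (simp add: regular_def range_fps_to_fls_closed)
  have "regular (1 :: 'a fls fps)" "regular (0 :: 'a fls fps)"
    using const[of 1] const[of 0] by (auto simp: regular_def)
  note 10 = this
  show "regular f \<Longrightarrow> regular (f ^ n)"
    by (induction n) (auto intro: mult 10)
  show "(\<And>x. x \<in> A \<Longrightarrow> regular (F x)) \<Longrightarrow> regular (sum F A :: 'a fls fps)"
    by (induction A rule: infinite_finite_induct) (auto intro: add 10)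
qed

text \<open>The recursion for the coefficients of the inverse divides only by \<open>f $ 0\<close>,
  which is a constant and does not involve \<open>x\<close>.\<close>

lemma regular_inverse:
  fixes f :: "'a::field fls fps"
  assumes "regular f" "f $ 0 = fls_const a" "a \<noteq> 0"
  shows "regular (inverse f)"
proof -
  have unit: "f * inverse f = 1"
    using assms by (intro inverse_mult_eq_1') (simp add: fls_const_nonzero)
  have "inverse f $ n \<in> range fps_to_fls" for n
  proof (induction n rule: less_induct)
    case (less n)
    have "(if n = 0 then 1 else 0) = (f * inverse f) $ n" by (simp add: unit)
    also have "\<dots> = fls_const a * inverse f $ n + (\<Sum>i=1..n. f $ i * inverse f $ (n - i))"
      by (simp add: fps_mult_nth sum.atLeast_Suc_atMost assms(2))
    finally have "fls_const a * inverse f $ n = (if n = 0 then 1 else 0) + - (\<Sum>i=1..n. f $ i * inverse f $ (n - i))"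
      by simp
    then have "fls_const (inverse a) * (fls_const a * inverse f $ n)
        = fls_const (inverse a) * (fls_const (if n = 0 then 1 else 0) + - (\<Sum>i=1..n. f $ i * inverse f $ (n - i)))"
      by simp
    then have "inverse f $ n = fls_const (inverse a) * (fls_const (if n = 0 then 1 else 0) + - (\<Sum>i=1..n. f $ i * inverse f $ (n - i)))"
      using assms(3) by (simp add: fls_const_mult_const flip: mult.assoc)
    moreover have "fls_const (inverse a) * (fls_const (if n = 0 then 1 else 0) + - (\<Sum>i=1..n. f $ i * inverse f $ (n - i))) \<in> range fps_to_fls"
      using less assms(1) by (intro range_fps_to_fls_closed) (auto simp: regular_def)
    ultimately show ?case by simp
  qed
  then show ?thesis by (simp add: regular_def)
qed

text \<open>The geometric series \<open>1 / (x - z) = \<Sum>k. z^k / x^(k + 1)\<close>.\<close>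

lemma inverse_fls_X_minus_const_nth:
  fixes z :: "'a::field fps"
  assumes "z $ 0 = 0"
  shows "fls_nth (inverse (fps_const fls_X - const_fls z) $ n) (- 2) = z $ n"
proof -
  define G where "G = inverse (fps_const fls_X - const_fls z)"
  have "(fps_const fls_X - const_fls z) * G = 1"
    unfolding G_def using assms by (intro inverse_mult_eq_1') simp
  then have "fps_const fls_X * G = 1 + const_fls z * G" by (simp add: algebra_simps)
  then have "(fps_const fls_X * G) $ n = (1 + const_fls z * G) $ n" for n by simp
  then have XG: "fls_X * G $ n = (if n = 0 then 1 else 0) + (\<Sum>i=0..n. fls_const (z $ i) * G $ (n - i))" for n
    by (simp only: fps_mult_left_const_nth fps_add_nth fps_one_nth fps_mult_nth[of "const_fls z"] const_fls_nth)
  have rec: "fls_nth (G $ n) m = (if n = 0 \<and> m = - 1 then 1 else 0) + (\<Sum>i=1..n. z $ i * fls_nth (G $ (n - i)) (m + 1))" for n m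
  proof -
    have "fls_nth (G $ n) m = fls_nth (fls_X * G $ n) (m + 1)"
      by (simp add: fls_X_times_conv_shift)
    also have "\<dots> = fls_nth (if n = 0 then 1 else 0) (m + 1) + (\<Sum>i=0..n. z $ i * fls_nth (G $ (n - i)) (m + 1))"
      unfolding XG by (simp add: fls_nth_sum)
    also have "(\<Sum>i=0..n. z $ i * fls_nth (G $ (n - i)) (m + 1)) = (\<Sum>i=1..n. z $ i * fls_nth (G $ (n - i)) (m + 1))"
      by (simp add: sum.atLeast_Suc_atMost[of 0] assms)
    also have "fls_nth (if n = 0 then 1 else 0) (m + 1) = (if n = 0 \<and> m = - 1 then 1 else (0 :: 'a))"
      by auto
    finally show ?thesis .
  qed
  \<comment> \<open>As \<open>z\<close> has no constant term, at exponents from -1 upwards only the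
    term \<open>1 / x\<close> at time 0 is left.\<close>
  have top: "fls_nth (G $ n) m = (if n = 0 \<and> m = - 1 then 1 else 0)" if "m \<ge> - 1" for n m
    using that
  proof (induction n arbitrary: m rule: less_induct)
    case (less n)
    have "(\<Sum>i=1..n. z $ i * fls_nth (G $ (n - i)) (m + 1)) = 0"
      using less by (intro sum.neutral) auto
    then show ?case by (subst rec) simp
  qed
  \<comment> \<open>The recursion now sees exponent -1 only, where just \<open>i = n\<close>
    contributes.\<close>
  have "fls_nth (G $ n) (- 2) = (\<Sum>i=1..n. z $ i * fls_nth (G $ (n - i)) (- 1))"
    by (subst rec) simp
  also have "\<dots> = (\<Sum>i=1..n. if i = n then z $ n else 0)"
    by (intro sum.cong) (auto simp: top)
  also have "\<dots> = z $ n" using assms by (cases "n = 0") auto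
  finally show ?thesis by (simp add: G_def)
qed


text \<open>With \<open>w = x - z\<close> one has \<open>P = w L\<close>, where
  \<open>L = A + w E\<close> is invertible without negative powers of \<open>x\<close>. Hence
  \<open>F = A / P\<close> equals \<open>1 / w - E / L\<close>, and the second term does not reach
  the exponent -2.\<close>

lemma rational_series_with_column:
  fixes z :: "'a::{idom,field} fps"
  assumes CHAR: "prime CHAR('a)" and Q: "Q = CHAR('a) ^ e" "Q \<ge> 2"
    and z0: "z $ 0 = 0" and A0: "coeff A 0 \<noteq> 0" and C0: "\<And>j. coeff (C j) 0 = 0" and B0: "coeff B 0 = 0"
    and rel: "fps_of_poly A * z + (\<Sum>j=1..K. fps_of_poly (C j) * z ^ (Q ^ j)) + fps_of_poly B = 0"
  defines "P \<equiv> const_fls (fps_of_poly A) * fps_const fls_X +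
    (\<Sum>j=1..K. const_fls (fps_of_poly (C j)) * fps_const fls_X ^ (Q ^ j)) + const_fls (fps_of_poly B)"
  shows "\<exists>F. P * F = const_fls (fps_of_poly A) \<and> (\<forall>n. fls_nth (F $ n) (- 2) = z $ n)"
proof -
  define x :: "'a fls fps" where "x = fps_const fls_X"
  define w where "w = x - const_fls z"
  define A' where "A' = const_fls (fps_of_poly A)"
  define C' where "C' j = const_fls (fps_of_poly (C j))" for j
  \<comment> \<open>The truncated subtraction is exact: \<open>Q^j \<ge> 2\<close> for
    \<open>j \<ge> 1\<close>, so two factors \<open>w\<close> can be split off each power.\<close>
  define E where "E = (\<Sum>j=1..K. C' j * w ^ (Q ^ j - 2))"
  define L where "L = A' + w * E"
  have w_reg: "regular w"
    unfolding w_def x_def using regular_closed(1)[of "fps_const fls_X" "- const_fls z"]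
    by (simp add: regular_closed) (simp add: regular_def range_fps_to_fls_closed)
  have frob: "x ^ (Q ^ j) = w ^ (Q ^ j) + const_fls z ^ (Q ^ j)" for j
  proof -
    have "(w + const_fls z) ^ (Q ^ j) = w ^ (Q ^ j) + const_fls z ^ (Q ^ j)"
      by (rule freshmans_dream'[of _ "e * j"]) (use CHAR Q in \<open>auto simp: power_mult\<close>)
    then show ?thesis by (simp add: w_def)
  qed
  have Q2: "Q ^ j \<ge> 2" if "j \<ge> 1" for j
    using Q(2) that self_le_power[of Q j] by linarith
  have "const_fls (fps_of_poly A * z + (\<Sum>j=1..K. fps_of_poly (C j) * z ^ (Q ^ j)) + fps_of_poly B) = 0"
    by (simp only: rel const_fls_hom)
  then have rel': "A' * const_fls z + (\<Sum>j=1..K. C' j * const_fls z ^ (Q ^ j)) + const_fls (fps_of_poly B) = 0"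
    by (simp only: const_fls_hom A'_def C'_def)
  \<comment> \<open>Expanding the powers of \<open>x = w + z\<close> separates \<open>P\<close> into
    a part divisible by \<open>w\<close> and its value at \<open>x = z\<close>, which vanishes by
    the relation for \<open>z\<close>.\<close>
  have "P = A' * (w + const_fls z) + (\<Sum>j=1..K. C' j * (w ^ (Q ^ j) + const_fls z ^ (Q ^ j))) + const_fls (fps_of_poly B)"
    unfolding P_def x_def[symmetric] frob A'_def C'_def by (simp add: w_def)
  also have "\<dots> = A' * w + (\<Sum>j=1..K. C' j * w ^ (Q ^ j))
      + (A' * const_fls z + (\<Sum>j=1..K. C' j * const_fls z ^ (Q ^ j)) + const_fls (fps_of_poly B))"
    by (simp add: algebra_simps sum.distrib)
  also have "\<dots> = A' * w + (\<Sum>j=1..K. C' j * w ^ (Q ^ j))" unfolding rel' by simp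
  also have "(\<Sum>j=1..K. C' j * w ^ (Q ^ j)) = w * (w * E)"
    unfolding E_def sum_distrib_left
  proof (intro sum.cong refl)
    fix j assume "j \<in> {1..K}"
    then have "2 + (Q ^ j - 2) = Q ^ j" using Q2[of j] by auto
    then have "w ^ (Q ^ j) = w ^ 2 * w ^ (Q ^ j - 2)" by (metis power_add)
    then show "C' j * w ^ (Q ^ j) = w * (w * (C' j * w ^ (Q ^ j - 2)))"
      by (simp add: power2_eq_square mult_ac)
  qed
  finally have P: "P = w * L" by (simp add: L_def algebra_simps)
  have E0: "E $ 0 = 0"
    unfolding E_def fps_sum_nth by (intro sum.neutral) (simp add: C'_def C0)
  then have L0: "L $ 0 = fls_const (coeff A 0)" by (simp add: L_def A'_def)
  have E_reg: "regular E" unfolding E_def C'_def by (intro regular_closed w_reg)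
  have L_reg: "regular L" unfolding L_def A'_def by (intro regular_closed w_reg E_reg)
  have iL_reg: "regular (inverse L)" by (rule regular_inverse[OF L_reg L0 A0])
  have wi: "w * inverse w = 1"
    by (rule inverse_mult_eq_1') (simp add: w_def x_def z0)
  have Li: "L * inverse L = 1"
    by (rule inverse_mult_eq_1') (simp add: L0 A0)
  define F where "F = A' * (inverse w * inverse L)"
  have "P * F = A' * ((w * inverse w) * (L * inverse L))"
    by (simp add: P F_def mult_ac)
  then have PF: "P * F = A'" by (simp add: wi Li)
  have "inverse w = inverse w * (L * inverse L)" by (simp add: Li)
  also have "\<dots> = F + (w * inverse w) * (E * inverse L)"
    by (simp add: L_def F_def algebra_simps)
  finally have F: "F = inverse w + - (E * inverse L)" by (simp add: wi)
  have "regular (- (E * inverse L))" by (intro regular_closed E_reg iL_reg)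
  then have "fls_nth ((- (E * inverse L)) $ n) (- 2) = 0" for n
    unfolding regular_def by (metis (no_types, lifting) fps_to_fls_nth image_iff neg_numeral_less_zero)
  then have "fls_nth (F $ n) (- 2) = z $ n" for n
    using inverse_fls_X_minus_const_nth[OF z0] by (simp add: F w_def x_def)
  with PF show ?thesis by (auto simp: A'_def)
qed

section \<open>Automatic sequences as columns\<close>

lemma laurent_polynomial_coeffs_closed:
  fixes f g :: "'a::comm_ring_1 fls fps" and c :: "'a fps"
  defines "lp \<equiv> \<lambda>f :: 'a fls fps. \<forall>n. laurent_polynomial (f $ n)"
  shows "lp f \<Longrightarrow> lp g \<Longrightarrow> lp (f + g)" "lp f \<Longrightarrow> lp g \<Longrightarrow> lp (f * g)" "lp f \<Longrightarrow> lp (f ^ n)"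
    "lp (const_fls c)" "laurent_polynomial h \<Longrightarrow> lp (fps_const h)" "lp fps_X"
    "(\<And>x. x \<in> A \<Longrightarrow> lp (F x)) \<Longrightarrow> lp (sum F A)"
proof -
  show "lp f \<Longrightarrow> lp g \<Longrightarrow> lp (f + g)" for f g
    by (auto simp: lp_def)
  show mult: "lp f \<Longrightarrow> lp g \<Longrightarrow> lp (f * g)" for f g
    by (auto simp: lp_def fps_mult_nth intro!: laurent_polynomial_sum)
  show "lp f \<Longrightarrow> lp (f ^ n)"
    by (induction n) (simp_all add: mult, simp add: lp_def)
  show "lp (const_fls c)" "lp fps_X" by (auto simp: lp_def)
  show "laurent_polynomial h \<Longrightarrow> lp (fps_const h)" by (auto simp: lp_def)
  show "(\<And>x. x \<in> A \<Longrightarrow> lp (F x)) \<Longrightarrow> lp (sum F A)"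
    by (auto simp: lp_def fps_sum_nth)
qed

theorem automatic_imp_column_of_linear_cellular_automaton:
  fixes u :: "nat \<Rightarrow> 'a::finite_field"
  assumes "automatic CHAR('a) UNIV u"
  shows "\<exists>d \<Phi> R m. d \<ge> 1 \<and> linear_cellular_automaton d \<Phi> \<and> (\<forall>i<d. eventually_periodic_both (R i)) \<and>
    (\<forall>n. spacetime_diagram d \<Phi> R n m = u n)"
proof -
  have CHAR: "prime CHAR('a)" by simp
  obtain e where e: "e > 0" "\<And>x :: 'a. x ^ (CHAR('a) ^ e) = x"
    using finite_field_power_CHAR_ex by blast
  define Q where "Q = CHAR('a) ^ e"
  have "CHAR('a) \<ge> 2" using CHAR prime_ge_2_nat by blast
  then have Q2: "Q \<ge> 2" unfolding Q_def using e(1) self_le_power[of "CHAR('a)" e] by linarith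
  have frob: "x ^ Q = x" for x :: 'a using e(2) by (simp add: Q_def)
  obtain S where S: "finite S" "u \<in> S" "\<And>v r. v \<in> S \<Longrightarrow> r < CHAR('a) \<Longrightarrow> (\<lambda>n. v (CHAR('a) * n + r)) \<in> S"
    using finite_kernel_if_automatic[OF assms] by blast
  have SQ: "(\<lambda>n. v (Q * n + r)) \<in> S" if "v \<in> S" "r < Q" for v r
    using finite_kernel_power[of S "CHAR('a)" v r e, OF S(3)] that unfolding Q_def by blast
  obtain K c where "\<exists>j\<le>K. c j \<noteq> 0" "(\<Sum>j\<le>K. fps_of_poly (c j) * Abs_fps u ^ (Q ^ j)) = 0"
    using Ore_relation_if_finite_kernel[OF CHAR Q_def frob S(1,2) SQ] by blast
  then obtain K c where c: "c 0 \<noteq> 0" "(\<Sum>j\<le>K. fps_of_poly (c j) * Abs_fps u ^ (Q ^ j)) = 0"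
    using separable_Ore_relation[OF CHAR Q_def frob] by blast
  obtain k T z A C B where nf: "Abs_fps u = fps_of_poly T + fps_X ^ k * z" "z $ 0 = 0" "coeff A 0 \<noteq> 0"
    "\<And>j. coeff (C j) 0 = 0" "coeff B 0 = 0"
    "fps_of_poly A * z + (\<Sum>j=1..K. fps_of_poly (C j) * z ^ (Q ^ j)) + fps_of_poly B = 0"
    by (rule Ore_relation_normal_form[OF CHAR Q_def Q2 c]) (rule that)
  define P where "P = const_fls (fps_of_poly A) * fps_const fls_X +
    (\<Sum>j=1..K. const_fls (fps_of_poly (C j)) * fps_const fls_X ^ (Q ^ j)) + const_fls (fps_of_poly B)"
  obtain F where F: "P * F = const_fls (fps_of_poly A)" "\<And>n. fls_nth (F $ n) (- 2) = z $ n"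
    using rational_series_with_column[OF CHAR Q_def Q2 nf(2-6)] unfolding P_def by blast
  \<comment> \<open>This is \<open>x^(-2)\<close>. It places the removed initial segment
    \<open>T\<close> in the column -2 that also carries \<open>z\<close>, so this column of
    \<open>V\<close> is \<open>T + t^k z\<close>.\<close>
  define h :: "'a fls" where "h = fls_shift 2 1"
  define V where "V = fps_const h * const_fls (fps_of_poly T) + fps_X ^ k * F"
  have V: "fls_nth (V $ n) (- 2) = u n" for n
  proof -
    have "fls_nth (V $ n) (- 2) = coeff T n + (if n < k then 0 else z $ (n - k))"
      using fls_X_intpow_times_conv_shift(1)[of "- 2" "fls_const (coeff T n)"]
      by (simp add: V_def h_def fps_X_power_mult_nth F(2))
    also have "\<dots> = (fps_of_poly T + fps_X ^ k * z) $ n"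
      by (simp add: fps_X_power_mult_nth)
    finally show ?thesis by (simp flip: nf(1))
  qed
  \<comment> \<open>The product \<open>P F = A\<close> removes the infinite series, so the numerator
    is polynomial in \<open>t\<close> with Laurent polynomials in \<open>x\<close> as
    coefficients.\<close>
  have PV: "P * V = fps_const h * (const_fls (fps_of_poly T) * P) + fps_X ^ k * const_fls (fps_of_poly A)"
    by (simp add: V_def distrib_left mult_ac flip: F(1))
  have h: "laurent_polynomial h" "laurent_polynomial (fls_X :: 'a fls)"
    using laurent_polynomial_shift[of "1 :: 'a fls"] by (auto simp: h_def fls_X_conv_shift_1)
  have lpP: "\<forall>n. laurent_polynomial (P $ n)"
    unfolding P_def by (intro laurent_polynomial_coeffs_closed h)
  have lpPV: "\<forall>n. laurent_polynomial ((P * V) $ n)"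
    unfolding PV by (intro laurent_polynomial_coeffs_closed h lpP)
  have polyP: "P \<in> range fps_of_poly"
    unfolding P_def by (intro range_fps_of_poly_closed const_fls_fps_of_poly)
  have polyPV: "P * V \<in> range fps_of_poly"
    unfolding PV by (intro range_fps_of_poly_closed const_fls_fps_of_poly polyP)
  \<comment> \<open>At \<open>t = 0\<close> the normal form leaves only the linear term, as required
    for solving the recurrence by a shift.\<close>
  have P0: "P $ 0 = fls_const (coeff A 0) * fls_X"
    by (simp add: P_def fps_sum_nth nf(4,5))
  obtain d \<Phi> R where "d \<ge> 1" "linear_cellular_automaton d \<Phi>" "\<forall>i<d. eventually_periodic_both (R i)"
    "\<forall>n m. spacetime_diagram d \<Phi> R n m = fls_nth (V $ n) m"
    using linear_cellular_automaton_if_rational[OF P0 nf(3) _ _ polyP polyPV] lpP lpPV by blast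
  then show ?thesis using V by (intro exI[of _ d] exI[of _ \<Phi>] exI[of _ R] exI[of _ "- 2"]) auto
qed

theorem theorem1p1:
  fixes p :: nat and u :: "nat \<Rightarrow> 'a :: finite_field"
  assumes "prime p" and "CHAR('a) = p"
  shows "automatic p UNIV u \<longleftrightarrow>
    (\<exists>d \<Phi> R m. d \<ge> 1 \<and> linear_cellular_automaton d \<Phi> \<and>
       (\<forall>i<d. eventually_periodic_both (R i)) \<and>
       (\<forall>n. spacetime_diagram d \<Phi> R n m = u n))"
proof
  assume "automatic p UNIV u"
  then show "\<exists>d \<Phi> R m. d \<ge> 1 \<and> linear_cellular_automaton d \<Phi> \<and>
       (\<forall>i<d. eventually_periodic_both (R i)) \<and>
       (\<forall>n. spacetime_diagram d \<Phi> R n m = u n)"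
    using automatic_imp_column_of_linear_cellular_automaton assms(2) by blast
next
  assume "\<exists>d \<Phi> R m. d \<ge> 1 \<and> linear_cellular_automaton d \<Phi> \<and>
       (\<forall>i<d. eventually_periodic_both (R i)) \<and>
       (\<forall>n. spacetime_diagram d \<Phi> R n m = u n)"
  then obtain d \<Phi> R m where \<Phi>: "linear_cellular_automaton d \<Phi>" "\<And>i. i < d \<Longrightarrow> eventually_periodic_both (R i)"
    and u: "\<And>n. spacetime_diagram d \<Phi> R n m = u n" by blast
  show "automatic p UNIV u"
    using column_of_linear_cellular_automaton_automatic[of d \<Phi> R m] \<Phi> assms(2) by (simp add: u)
qed

end
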